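(* Let $\mathcal H$ be a complex Hilbert space with scalar product $\langle\cdot,\cdot\rangle$ and norm $\|\cdot\|$. Let $\mathfrak a$ be a densely defined, continuous, closed (not necessarily symmetric) sesquilinear form on $\mathcal H$ which is bounded from below, i.e. there is $\eta\in\mathbb R$ with $\operatorname{Re}\mathfrak a(u,u)+\eta\|u\|^2\ge 0$ for all $u\in D(\mathfrak a)$. Let $A$ be the operator associated with $\mathfrak a$, let $\mathfrak h(u,v):=\frac12\big(\mathfrak a(u,v)+\overline{\mathfrak a(v,u)}\big)$ on $D(\mathfrak h)=D(\mathfrak a)$ be the symmetric part of $\mathfrak a$, and let $H$ be the self-adjoint operator associated with $\mathfrak h$. (i) If $H$ has no spectrum in $(-\infty,0)$, then $A$ has no eigenvalue in $\{z\in\mathbb C:\operatorname{Re} z<0\}$. (ii) Assume that the spectrum of $H$ in $(-\infty,0)$ is discrete. Let $\lambda_1,\dots,\lambda_N$ be any finite family of eigenvalues of $A$ with $\operatorname{Re}\lambda_j<0$ for all $j$, where an eigenvalue of algebraic multiplicity $k$ may occur $n$ times in the family with $n\le k$. Then for every $\gamma\ge 1$, $$\sum_{k=1}^N(-\operatorname{Re}\lambda_k)^\gamma\le \operatorname{Tr}(H)_-^\gamma .$$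
   Context: The operator associated with a closed densely defined sectorial form $\mathfrak a$ is the operator $A$ with $D(A)=\{u\in D(\mathfrak a):\exists f\in\mathcal H,\ \mathfrak a(u,v)=\langle f,v\rangle\ \forall v\in D(\mathfrak a)\}$, $Au=f$. The algebraic multiplicity of an eigenvalue $\lambda$ of $A$ is $\sup_{k\in\mathbb N}\dim\ker(\lambda I-A)^k$. "Discrete spectrum in $(-\infty,0)$" means the spectrum of $H$ in $(-\infty,0)$ consists of isolated eigenvalues of finite multiplicity. $\operatorname{Tr}(H)_-^\gamma:=\sum_j(-\mu_j)^\gamma$, where $\mu_j$ runs over the negative eigenvalues of $H$ repeated according to multiplicity (this may be $+\infty$). *)

theory Defs
  imports "HOL-Analysis.Analysis" "HOL-Library.Extended_Nat" "HOL-Library.Extended_Nonnegative_Real"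
begin

class complex_inner = real_normed_vector +
  fixes scaleC :: "complex \<Rightarrow> 'a \<Rightarrow> 'a" (infixr \<open>*\<^sub>C\<close> 75)
    and cinner :: "'a \<Rightarrow> 'a \<Rightarrow> complex"
  assumes scaleC_add_right: "a *\<^sub>C (x + y) = a *\<^sub>C x + a *\<^sub>C y"
    and scaleC_add_left: "(a + b) *\<^sub>C x = a *\<^sub>C x + b *\<^sub>C x"
    and scaleC_scaleC: "a *\<^sub>C (b *\<^sub>C x) = (a * b) *\<^sub>C x"
    and scaleC_one: "1 *\<^sub>C x = x"
    and scaleR_scaleC: "scaleR r x = complex_of_real r *\<^sub>C x"
    and cinner_add_left: "cinner (x + y) z = cinner x z + cinner y z"
    and cinner_scaleC_left: "cinner (a *\<^sub>C x) y = a * cinner x y"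
    and cinner_commute: "cinner y x = cnj (cinner x y)"
    and cinner_ge_zero: "0 \<le> Re (cinner x x)"
    and cinner_eq_zero_iff: "cinner x x = 0 \<longleftrightarrow> x = 0"
    and norm_eq_sqrt_cinner: "norm x = sqrt (Re (cinner x x))"

class chilbert_space = complex_inner + complete_space


instantiation complex :: complex_inner
begin
definition scaleC_complex :: "complex \<Rightarrow> complex \<Rightarrow> complex" where "scaleC_complex a x = a * x"
definition cinner_complex :: "complex \<Rightarrow> complex \<Rightarrow> complex" where "cinner_complex x y = x * cnj y"
instance
proof
  fix x :: complex
  show "norm x = sqrt (Re (cinner x x))"
    by (simp add: cinner_complex_def complex_mult_cnj cmod_def)
next
  fix x :: complex
  show "cinner x x = 0 \<longleftrightarrow> x = 0"
    by (simp add: cinner_complex_def)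
qed (auto simp: scaleC_complex_def cinner_complex_def algebra_simps scaleR_conv_of_real complex_mult_cnj)
end

instance complex :: chilbert_space ..

definition csubspace :: "'a::complex_inner set \<Rightarrow> bool" where
  "csubspace D \<longleftrightarrow> 0 \<in> D \<and> (\<forall>x\<in>D. \<forall>y\<in>D. x + y \<in> D) \<and> (\<forall>c. \<forall>x\<in>D. c *\<^sub>C x \<in> D)"

definition sesquilinear_form :: "'a::complex_inner set \<Rightarrow> ('a \<Rightarrow> 'a \<Rightarrow> complex) \<Rightarrow> bool" where
  "sesquilinear_form D a \<longleftrightarrow> csubspace D \<and>
     (\<forall>u\<in>D. \<forall>u'\<in>D. \<forall>v\<in>D. a (u + u') v = a u v + a u' v) \<and>
     (\<forall>c. \<forall>u\<in>D. \<forall>v\<in>D. a (c *\<^sub>C u) v = c * a u v) \<and>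
     (\<forall>u\<in>D. \<forall>v\<in>D. \<forall>v'\<in>D. a u (v + v') = a u v + a u v') \<and>
     (\<forall>c. \<forall>u\<in>D. \<forall>v\<in>D. a u (c *\<^sub>C v) = cnj c * a u v)"

definition densely_defined :: "'a::complex_inner set \<Rightarrow> bool" where
  "densely_defined D \<longleftrightarrow> closure D = UNIV"

definition form_bounded_below :: "'a::complex_inner set \<Rightarrow> ('a \<Rightarrow> 'a \<Rightarrow> complex) \<Rightarrow> real \<Rightarrow> bool" where
  "form_bounded_below D a \<eta> \<longleftrightarrow> (\<forall>u\<in>D. Re (a u u) + \<eta> * (norm u)\<^sup>2 \<ge> 0)"

text \<open>Continuity: |a(u,v)| <= M ||u||_a ||v||_a for the form norm
  ||u||_a = (Re a(u,u) + w ||u||^2)^(1/2), for some admissible shift w.\<close>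
definition continuous_form :: "'a::complex_inner set \<Rightarrow> ('a \<Rightarrow> 'a \<Rightarrow> complex) \<Rightarrow> bool" where
  "continuous_form D a \<longleftrightarrow> (\<exists>w M. form_bounded_below D a w \<and>
     (\<forall>u\<in>D. \<forall>v\<in>D. cmod (a u v) \<le>
        M * sqrt (Re (a u u) + w * (norm u)\<^sup>2) * sqrt (Re (a v v) + w * (norm v)\<^sup>2)))"

definition closed_form :: "'a::complex_inner set \<Rightarrow> ('a \<Rightarrow> 'a \<Rightarrow> complex) \<Rightarrow> bool" where
  "closed_form D a \<longleftrightarrow> (\<forall>(x::nat \<Rightarrow> 'a) u. (\<forall>n. x n \<in> D) \<longrightarrow> x \<longlonglongrightarrow> u \<longrightarrow>
      (\<forall>\<epsilon>>0. \<exists>N. \<forall>n\<ge>N. \<forall>m\<ge>N. cmod (a (x n - x m) (x n - x m)) < \<epsilon>) \<longrightarrow>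
      u \<in> D \<and> (\<lambda>n. a (x n - u) (x n - u)) \<longlonglongrightarrow> 0)"

definition sym_part :: "('a \<Rightarrow> 'a \<Rightarrow> complex) \<Rightarrow> 'a \<Rightarrow> 'a \<Rightarrow> complex" where
  "sym_part a u v = (a u v + cnj (a v u)) / 2"

definition assoc_dom :: "'a::complex_inner set \<Rightarrow> ('a \<Rightarrow> 'a \<Rightarrow> complex) \<Rightarrow> 'a set" where
  "assoc_dom D a = {u \<in> D. \<exists>f. \<forall>v\<in>D. a u v = cinner f v}"

definition assoc_op :: "'a::complex_inner set \<Rightarrow> ('a \<Rightarrow> 'a \<Rightarrow> complex) \<Rightarrow> 'a \<Rightarrow> 'a" where
  "assoc_op D a u = (THE f. \<forall>v\<in>D. a u v = cinner f v)"

definition resolvent_set :: "'a::complex_inner set \<Rightarrow> ('a \<Rightarrow> 'a) \<Rightarrow> complex set" where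
  "resolvent_set DT T = {z. bij_betw (\<lambda>u. z *\<^sub>C u - T u) DT UNIV \<and>
      (\<exists>C. \<forall>u\<in>DT. norm u \<le> C * norm (z *\<^sub>C u - T u))}"

definition op_spectrum :: "'a::complex_inner set \<Rightarrow> ('a \<Rightarrow> 'a) \<Rightarrow> complex set" where
  "op_spectrum DT T = - resolvent_set DT T"

definition is_eigenvalue :: "'a::complex_inner set \<Rightarrow> ('a \<Rightarrow> 'a) \<Rightarrow> complex \<Rightarrow> bool" where
  "is_eigenvalue DT T z \<longleftrightarrow> (\<exists>u\<in>DT. u \<noteq> 0 \<and> T u = z *\<^sub>C u)"

fun gen_kernel :: "'a::complex_inner set \<Rightarrow> ('a \<Rightarrow> 'a) \<Rightarrow> complex \<Rightarrow> nat \<Rightarrow> 'a set" where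
  "gen_kernel DT T z 0 = {0}"
| "gen_kernel DT T z (Suc k) = {u \<in> DT. z *\<^sub>C u - T u \<in> gen_kernel DT T z k}"

definition cindependent :: "'a::complex_inner set \<Rightarrow> bool" where
  "cindependent B \<longleftrightarrow> (\<forall>c. (\<Sum>b\<in>B. c b *\<^sub>C b) = 0 \<longrightarrow> (\<forall>b\<in>B. c b = 0))"

definition cdim :: "'a::complex_inner set \<Rightarrow> enat" where
  "cdim S = (SUP B \<in> {B. finite B \<and> B \<subseteq> S \<and> cindependent B}. enat (card B))"

definition alg_mult :: "'a::complex_inner set \<Rightarrow> ('a \<Rightarrow> 'a) \<Rightarrow> complex \<Rightarrow> enat" where
  "alg_mult DT T z = (SUP k. cdim (gen_kernel DT T z k))"

definition discrete_neg_spectrum :: "'a::complex_inner set \<Rightarrow> ('a \<Rightarrow> 'a) \<Rightarrow> bool" where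
  "discrete_neg_spectrum DT T \<longleftrightarrow> (\<forall>r::real. r < 0 \<longrightarrow> complex_of_real r \<in> op_spectrum DT T \<longrightarrow>
      (\<exists>\<epsilon>>0. op_spectrum DT T \<inter> ball (complex_of_real r) \<epsilon> = {complex_of_real r}) \<and>
      is_eigenvalue DT T (complex_of_real r) \<and> alg_mult DT T (complex_of_real r) < \<infinity>)"

text \<open>Tr(T)_-^\<gamma> = sum over negative eigenvalues mu (with multiplicity) of (-mu)^\<gamma>, possibly \<infinity>;
  defined as the supremum of the finite partial sums.\<close>
definition neg_trace :: "'a::complex_inner set \<Rightarrow> ('a \<Rightarrow> 'a) \<Rightarrow> real \<Rightarrow> ennreal" where
  "neg_trace DT T \<gamma> = (SUP F \<in> {F. finite F \<and> (\<forall>\<mu>\<in>F. \<mu> < 0 \<and> is_eigenvalue DT T (complex_of_real \<mu>))}.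
      \<Sum>\<mu>\<in>F. ennreal_of_enat (alg_mult DT T (complex_of_real \<mu>)) * ennreal ((- \<mu>) powr \<gamma>))"

end

(* The generalized eigenvectors of A admit a Schur basis: orthonormal e_1, ..., e_N in D(A) with
   a(e_k, e_k) = lambda_k, so that h(e_k, e_k) = Re lambda_k. With phi_j a maximal (finite) orthonormal
   family of eigenvectors of H with eigenvalues mu_j < -delta, the variational inequality
   h(e, e) >= sum_j mu_j |<e, phi_j>|^2 - delta |e|^2 and convexity of t^gamma yield
   (-Re lambda_k - delta)^gamma <= sum_j (-mu_j)^gamma |<e_k, phi_j>|^2; sum over k with Bessel's
   inequality and let delta tend to 0.

   No spectral theorem is needed for the variational inequality: it is read off the resolvent
   R = (H + w)^(-1). If sup R on the complement of the phi_j were too large, it would be an isolated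
   spectral point of R there, hence an eigenvalue, against maximality. *)
theory Submission
  imports Defs
begin

section \<open>Sesquilinear forms and the Riesz representation\<close>

text \<open>\<open>A\<close> need not be normal: its eigenvectors need not be orthogonal, and
  algebraic multiplicity counts vectors that are not eigenvectors. Orthonormalising generalized
  eigenvectors preserves the diagonal of a triangular matrix, and the diagonal is all that is
  needed: on it, passing from \<open>a\<close> to \<open>sym_part a\<close> just takes real parts.

  The cut-off \<delta> is there because negative eigenvalues of \<open>H\<close> may accumulate at
  0. If the trace is finite, each eigenvector below -\<delta> uses up at least \<delta>^\<gamma> of
  it, so a maximal family exists and is finite; if it is infinite, nothing is to be shown.

  Bessel's inequality acts in both indices of the weights |<e_k, phi_j>|^2. Summed over j they total
  at most 1, which is what convexity requires; summed over k they total at most 1, which lets each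
  eigenvalue of \<open>H\<close> be charged only once.

  Claim (i) comes from the same variational inequality with the empty family.\<close>

interpretation complex_vector: vector_space "scaleC :: complex \<Rightarrow> 'a \<Rightarrow> 'a::complex_inner"
  by unfold_locales
    (simp_all add: scaleC_add_right scaleC_add_left scaleC_scaleC scaleC_one)

lemma csubspace_iff: "csubspace D \<longleftrightarrow> complex_vector.subspace D"
  by (simp add: csubspace_def complex_vector.subspace_def)

lemma csubspaceD:
  assumes "csubspace D"
  shows "0 \<in> D" "x \<in> D \<Longrightarrow> y \<in> D \<Longrightarrow> x + y \<in> D" "x \<in> D \<Longrightarrow> c *\<^sub>C x \<in> D"
    "x \<in> D \<Longrightarrow> y \<in> D \<Longrightarrow> x - y \<in> D" "x \<in> D \<Longrightarrow> - x \<in> D"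
  using assms unfolding csubspace_iff
  by (auto intro: complex_vector.subspace_0 complex_vector.subspace_add complex_vector.subspace_scale
      complex_vector.subspace_diff complex_vector.subspace_neg)

lemma cinner_add_right: "cinner x (y + z) = cinner x y + cinner x z"
  by (metis cinner_add_left cinner_commute complex_cnj_add)

lemma cinner_scaleC_right: "cinner x (a *\<^sub>C y) = cnj a * cinner x y"
  by (metis cinner_scaleC_left cinner_commute complex_cnj_mult)

lemma cinner_zero_left [simp]: "cinner 0 x = 0"
  using cinner_add_left[of 0 0 x] by simp

lemma cinner_zero_right [simp]: "cinner x 0 = 0"
  using cinner_add_right[of x 0 0] by simp

lemma cinner_minus_left: "cinner (- x) y = - cinner x y"
  using cinner_add_left[of x "- x" y] by (simp add: eq_neg_iff_add_eq_0 add.commute)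

lemma cinner_minus_right: "cinner x (- y) = - cinner x y"
  using cinner_add_right[of x y "- y"] by (simp add: eq_neg_iff_add_eq_0 add.commute)

lemma cinner_diff_left: "cinner (x - y) z = cinner x z - cinner y z"
  by (metis cinner_add_left cinner_minus_left diff_conv_add_uminus)

lemma cinner_diff_right: "cinner x (y - z) = cinner x y - cinner x z"
  by (metis cinner_add_right cinner_minus_right diff_conv_add_uminus)

lemma cinner_sum_left: "cinner (\<Sum>i\<in>I. f i) y = (\<Sum>i\<in>I. cinner (f i) y)"
  by (induction I rule: infinite_finite_induct) (auto simp: cinner_add_left)

lemma cinner_sum_right: "cinner x (\<Sum>i\<in>I. f i) = (\<Sum>i\<in>I. cinner x (f i))"
  by (induction I rule: infinite_finite_induct) (auto simp: cinner_add_right)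

lemma cinner_self: "cinner x x = complex_of_real ((norm x)\<^sup>2)"
proof (rule complex_eqI)
  show "Re (cinner x x) = Re (complex_of_real ((norm x)\<^sup>2))"
    by (simp add: norm_eq_sqrt_cinner cinner_ge_zero)
  show "Im (cinner x x) = Im (complex_of_real ((norm x)\<^sup>2))"
    using arg_cong[OF cinner_commute[of x x], of Im] by simp
qed

lemma norm_scaleC: "norm (a *\<^sub>C x) = cmod a * norm (x::'a::complex_inner)"
proof -
  have "cinner (a *\<^sub>C x) (a *\<^sub>C x) = a * cnj a * cinner x x"
    by (simp add: cinner_scaleC_left cinner_scaleC_right)
  then have "complex_of_real ((norm (a *\<^sub>C x))\<^sup>2) = complex_of_real ((cmod a * norm x)\<^sup>2)"
    by (simp add: cinner_self power_mult_distrib flip: complex_norm_square)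
  then have "(norm (a *\<^sub>C x))\<^sup>2 = (cmod a * norm x)\<^sup>2"
    using of_real_eq_iff by blast
  then show ?thesis
    by (simp add: power2_eq_iff_nonneg)
qed

lemma sesquilinear_formD:
  assumes "sesquilinear_form D a"
  shows "csubspace D"
    and "u \<in> D \<Longrightarrow> u' \<in> D \<Longrightarrow> v \<in> D \<Longrightarrow> a (u + u') v = a u v + a u' v"
    and "u \<in> D \<Longrightarrow> v \<in> D \<Longrightarrow> a (c *\<^sub>C u) v = c * a u v"
    and "u \<in> D \<Longrightarrow> v \<in> D \<Longrightarrow> v' \<in> D \<Longrightarrow> a u (v + v') = a u v + a u v'"
    and "u \<in> D \<Longrightarrow> v \<in> D \<Longrightarrow> a u (c *\<^sub>C v) = cnj c * a u v"
  using assms unfolding sesquilinear_form_def by blast+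

lemma sesquilinear_form_diff:
  assumes a: "sesquilinear_form D a" and D: "u \<in> D" "v \<in> D" "w \<in> D"
  shows "a (u - v) w = a u w - a v w" "a w (u - v) = a w u - a w v"
proof -
  have uv: "u - v \<in> D"
    using sesquilinear_formD(1)[OF a] D csubspaceD by blast
  show "a (u - v) w = a u w - a v w"
    using sesquilinear_formD(2)[OF a uv D(2,3)] by simp
  show "a w (u - v) = a w u - a w v"
    using sesquilinear_formD(4)[OF a D(3) uv D(2)] by simp
qed

lemma sesquilinear_form_0:
  assumes a: "sesquilinear_form D a" and "u \<in> D"
  shows "a 0 u = 0" "a u 0 = 0"
  using sesquilinear_form_diff[OF a assms(2) assms(2) assms(2)] by simp_all

lemma sesquilinear_form_sum_left:
  assumes a: "sesquilinear_form D a" and "\<And>i. i \<in> I \<Longrightarrow> f i \<in> D" "v \<in> D"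
  shows "a (\<Sum>i\<in>I. f i) v = (\<Sum>i\<in>I. a (f i) v)"
  using assms(2)
proof (induction I rule: infinite_finite_induct)
  case (insert i I)
  have "(\<Sum>i\<in>I. f i) \<in> D"
    using sesquilinear_formD(1)[OF a] insert.prems unfolding csubspace_iff
    by (intro complex_vector.subspace_sum) auto
  then show ?case
    using insert sesquilinear_formD(2)[OF a _ _ assms(3)] by simp
qed (auto simp: sesquilinear_form_0[OF a assms(3)])

text \<open>Only semidefinite and only on a subspace, so that one Cauchy-Schwarz inequality serves
  \<open>cinner\<close> on a closed subspace, the shifted form \<open>q\<close>, and operator forms
  \<open>cinner (S u) v\<close>.\<close>

locale semi_inner_form =
  fixes D :: "'a::complex_inner set" and q :: "'a \<Rightarrow> 'a \<Rightarrow> complex"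
  assumes form: "sesquilinear_form D q"
    and hermitian: "u \<in> D \<Longrightarrow> v \<in> D \<Longrightarrow> q v u = cnj (q u v)"
    and nonneg: "u \<in> D \<Longrightarrow> 0 \<le> Re (q u u)"
begin

lemmas subspace = sesquilinear_formD(1)[OF form]
lemmas closed_under = csubspaceD[OF subspace]

lemma diagonal_add_scaleC:
  assumes "x \<in> D" "v \<in> D"
  shows "Re (q (x + t *\<^sub>C v) (x + t *\<^sub>C v))
    = Re (q x x) + 2 * Re (cnj t * q x v) + (cmod t)\<^sup>2 * Re (q v v)"
proof -
  have "q (x + t *\<^sub>C v) (x + t *\<^sub>C v) = q x x + cnj t * q x v + t * cnj (q x v) + (t * cnj t) * q v v"
    using assms closed_under hermitian[OF assms]
    by (simp add: sesquilinear_formD[OF form] algebra_simps)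
  then show ?thesis
    by (simp flip: complex_norm_square)
qed

lemma cauchy_schwarz:
  assumes "x \<in> D" "v \<in> D"
  shows "(cmod (q x v))\<^sup>2 \<le> Re (q x x) * Re (q v v)"
proof -
  define z s where "z = (cmod (q x v))\<^sup>2" and "s = Re (q v v)"
  \<comment> \<open>The test vector is x + t v with t = -r q(x,v). This phase makes the cross term
    real and leaves a real quadratic in r.\<close>
  have le: "0 \<le> Re (q x x) - 2 * r * z + r\<^sup>2 * z * s" for r :: real
  proof -
    have "0 \<le> Re (q (x + (- of_real r * q x v) *\<^sub>C v) (x + (- of_real r * q x v) *\<^sub>C v))"
      using assms closed_under by (intro nonneg) auto
    also have "Re (cnj (- of_real r * q x v) * q x v) = - r * z"
    proof -
      have "cnj (- of_real r * q x v) * q x v = of_real (- r * z)"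
        by (simp add: z_def complex_norm_square mult.commute del: of_real_power)
      then show ?thesis by (metis Re_complex_of_real)
    qed
    moreover have "(cmod (- of_real r * q x v))\<^sup>2 = r\<^sup>2 * z"
      by (simp add: z_def norm_mult power_mult_distrib)
    ultimately show ?thesis
      using diagonal_add_scaleC[OF assms, of "- of_real r * q x v"] by (simp add: s_def)
  qed
  have s: "s \<ge> 0" and z: "z \<ge> 0"
    using nonneg assms by (auto simp: s_def z_def)
  show ?thesis
  proof (cases "s = 0")
    case True
    have "z = 0"
    proof (rule ccontr)
      assume "z \<noteq> 0"
      \<comment> \<open>For s = 0 the expression is affine in r with slope -2z; the chosen r gives
        it the value -1.\<close>
      then show False
        using le[of "(Re (q x x) + 1) / (2 * z)"] True z by (simp add: field_simps)
    qed
    then show ?thesis using True by (simp add: z_def s_def)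
  next
    case False
    then have "0 \<le> Re (q x x) - z / s"
      using le[of "1 / s"] by (simp add: power2_eq_square field_simps)
    then show ?thesis
      using False s by (simp add: z_def s_def field_simps)
  qed
qed

text \<open>Dirichlet principle: minimise J(v) = q(v,v) - 2 Re l(v). A minimising sequence is Cauchy
  by the parallelogram law, and the vanishing first variation at its limit is the representation.
  The functional is conjugate linear because \<open>q\<close> is so in its second argument.\<close>

lemma riesz_representation:
  assumes complete: "\<And>x::nat \<Rightarrow> 'a. (\<And>n. x n \<in> D) \<Longrightarrow>
      (\<forall>e>0. \<exists>N. \<forall>n\<ge>N. \<forall>m\<ge>N. Re (q (x n - x m) (x n - x m)) < e) \<Longrightarrow>
      \<exists>u\<in>D. (\<lambda>n. Re (q (x n - u) (x n - u))) \<longlonglongrightarrow> 0"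
    and add: "\<And>u v. u \<in> D \<Longrightarrow> v \<in> D \<Longrightarrow> l (u + v) = l u + l v"
    and scale: "\<And>c u. u \<in> D \<Longrightarrow> l (c *\<^sub>C u) = cnj c * l u"
    and bounded: "\<And>u. u \<in> D \<Longrightarrow> (cmod (l u))\<^sup>2 \<le> C * Re (q u u)"
  shows "\<exists>u\<in>D. \<forall>v\<in>D. q u v = l v"
proof -
  define J where "J v = Re (q v v) - 2 * Re (l v)" for v
  have J_ge: "- C \<le> J v" if "v \<in> D" "C \<ge> 0" for v
  proof -
    have "Re (l v) \<le> sqrt (C * Re (q v v))"
      using order_trans[OF complex_Re_le_cmod real_le_rsqrt[OF bounded[OF that(1)]]] .
    also have "\<dots> \<le> (C + Re (q v v)) / 2"
      using arith_geo_mean_sqrt[OF that(2) nonneg[OF that(1)]] .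
    finally show ?thesis by (simp add: J_def)
  qed
  \<comment> \<open>The sign of \<open>C\<close> is unknown; a negative \<open>C\<close> forces l =
    0.\<close>
  have J_lower: "- max C 0 \<le> J v" if "v \<in> D" for v
  proof (cases "C \<ge> 0")
    case False
    then have "C * Re (q v v) \<le> 0" using nonneg[OF that] by (simp add: mult_nonpos_nonneg)
    then have "(cmod (l v))\<^sup>2 \<le> 0" using bounded[OF that] by linarith
    then have "l v = 0" by simp
    then show ?thesis using nonneg[OF that] by (simp add: J_def)
  qed (use J_ge that in auto)
  define d where "d = (INF v\<in>D. J v)"
  have bdd: "bdd_below (J ` D)"
    using J_lower by (intro bdd_belowI2) auto
  have d_le: "d \<le> J v" if "v \<in> D" for v
    unfolding d_def by (rule cINF_lower[OF bdd that])
  have "\<exists>x\<in>D. J x < d + 1 / real (Suc n)" for n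
  proof -
    have "(INF v\<in>D. J v) < d + 1 / real (Suc n)" by (simp add: d_def)
    then show ?thesis using cINF_less_iff[OF _ bdd] closed_under(1) by blast
  qed
  then obtain x where x: "\<And>n. x n \<in> D" "\<And>n. J (x n) < d + 1 / real (Suc n)"
    by metis
  have l_half: "l ((1/2) *\<^sub>C u) = l u / 2" if "u \<in> D" for u
    using scale[OF that, of "1/2"] by simp
  \<comment> \<open>The parallelogram law, with the midpoint of u and v tested against the infimum
    \<open>d\<close>.\<close>
  have par: "Re (q (u - v) (u - v)) \<le> 2 * J u + 2 * J v - 4 * d" if "u \<in> D" "v \<in> D" for u v
  proof -
    have uv: "u + v \<in> D" using that closed_under by blast
    have "J ((1/2) *\<^sub>C (u + v)) = Re (q (u + v) (u + v)) / 4 - Re (l u + l v)"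
      using uv that closed_under(3)
      by (simp add: J_def l_half add sesquilinear_formD[OF form] add_divide_distrib)
    moreover have "Re (q (u - v) (u - v)) + Re (q (u + v) (u + v)) = 2 * Re (q u u) + 2 * Re (q v v)"
      using diagonal_add_scaleC[OF that, of 1] diagonal_add_scaleC[OF that, of "-1"]
      by simp
    moreover have "d \<le> J ((1/2) *\<^sub>C (u + v))" using uv closed_under by (intro d_le) auto
    ultimately show ?thesis by (simp add: J_def)
  qed
  have cauchy: "\<forall>e>0. \<exists>N. \<forall>n\<ge>N. \<forall>m\<ge>N. Re (q (x n - x m) (x n - x m)) < e"
  proof (intro allI impI)
    fix e :: real assume "e > 0"
    then obtain N where N: "1 / real (Suc N) < e / 4"
      using nat_approx_posE[of "e/4"] by auto
    have "Re (q (x n - x m) (x n - x m)) < e" if "n \<ge> N" "m \<ge> N" for n m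
    proof -
      have "1 / real (Suc n) \<le> 1 / real (Suc N)" "1 / real (Suc m) \<le> 1 / real (Suc N)"
        using that by (auto intro!: divide_left_mono)
      then show ?thesis using par[OF x(1) x(1), of n m] x(2)[of n] x(2)[of m] N by linarith
    qed
    then show "\<exists>N. \<forall>n\<ge>N. \<forall>m\<ge>N. Re (q (x n - x m) (x n - x m)) < e" by blast
  qed
  obtain u where u: "u \<in> D" "(\<lambda>n. Re (q (x n - u) (x n - u))) \<longlonglongrightarrow> 0"
    using complete[OF x(1) cauchy] by auto
  have conv: "(\<lambda>n. q (x n) v) \<longlonglongrightarrow> q u v" if v: "v \<in> D" for v
  proof -
    have "(\<lambda>n. sqrt (Re (q (x n - u) (x n - u)) * Re (q v v))) \<longlonglongrightarrow> sqrt (0 * Re (q v v))"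
      by (intro tendsto_intros u(2))
    then have "(\<lambda>n. sqrt (Re (q (x n - u) (x n - u)) * Re (q v v))) \<longlonglongrightarrow> 0" by simp
    then have "(\<lambda>n. q (x n) v - q u v) \<longlonglongrightarrow> 0"
    proof (rule Lim_null_comparison[rotated], intro always_eventually allI)
      fix n
      have "(cmod (q (x n - u) v))\<^sup>2 \<le> Re (q (x n - u) (x n - u)) * Re (q v v)"
        using x(1) u(1) v closed_under by (intro cauchy_schwarz) auto
      then show "cmod (q (x n) v - q u v) \<le> sqrt (Re (q (x n - u) (x n - u)) * Re (q v v))"
        using sesquilinear_form_diff(1)[OF form x(1) u(1) v] real_le_rsqrt by metis
    qed
    then show ?thesis by (simp add: LIM_zero_iff)
  qed
  \<comment> \<open>The variational inequality is carried to the limit from the almost-minimisers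
    \<open>x n\<close>, so J itself need not be evaluated at u.\<close>
  have var: "0 \<le> (cmod t)\<^sup>2 * Re (q v v) + 2 * Re (cnj t * (q u v - l v))" if v: "v \<in> D" for v t
  proof -
    have le: "- (1 / real (Suc n)) \<le> (cmod t)\<^sup>2 * Re (q v v) + 2 * Re (cnj t * (q (x n) v - l v))" for n
    proof -
      have "d \<le> J (x n + t *\<^sub>C v)" using x(1) v closed_under by (intro d_le) auto
      also have "\<dots> = J (x n) + (cmod t)\<^sup>2 * Re (q v v) + 2 * Re (cnj t * (q (x n) v - l v))"
        unfolding J_def diagonal_add_scaleC[OF x(1) v]
        using x(1) v closed_under(3) by (simp add: add scale algebra_simps)
      finally show ?thesis using x(2)[of n] by linarith
    qed
    have lim0: "(\<lambda>n. - (1 / real (Suc n))) \<longlonglongrightarrow> - 0"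
      using LIMSEQ_inverse_real_of_nat by (intro tendsto_minus) (simp add: inverse_eq_divide)
    have lim: "(\<lambda>n. (cmod t)\<^sup>2 * Re (q v v) + 2 * Re (cnj t * (q (x n) v - l v)))
        \<longlonglongrightarrow> (cmod t)\<^sup>2 * Re (q v v) + 2 * Re (cnj t * (q u v - l v))"
      by (intro tendsto_intros conv[OF v])
    show ?thesis
      using LIMSEQ_le[OF lim0 lim] le by auto
  qed
  have "q u v = l v" if v: "v \<in> D" for v
  proof (rule ccontr)
    assume neq: "q u v \<noteq> l v"
    \<comment> \<open>Descent with t = -s g, where s is so small that the quadratic term cannot
      offset the linear one; the 1 in the denominator covers q(v,v) = 0.\<close>
    define g s where "g = q u v - l v" and "s = 1 / (Re (q v v) + 1)"
    have s: "s > 0" "s * Re (q v v) < 1"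
      using nonneg[OF v] by (auto simp: s_def field_simps)
    have "cnj (- of_real s * g) * g = of_real (- s * (cmod g)\<^sup>2)"
      by (simp add: complex_norm_square mult.commute del: of_real_power)
    then have re: "Re (cnj (- of_real s * g) * g) = - s * (cmod g)\<^sup>2"
      by (metis Re_complex_of_real)
    have "0 \<le> (s * cmod g)\<^sup>2 * Re (q v v) + 2 * (- s * (cmod g)\<^sup>2)"
      using var[OF v, of "- of_real s * g"] s(1) unfolding g_def[symmetric] re
      by (simp add: norm_mult)
    also have "\<dots> = s * (cmod g)\<^sup>2 * (s * Re (q v v) - 2)"
      by (simp add: power2_eq_square algebra_simps)
    finally have "0 \<le> s * (cmod g)\<^sup>2 * (s * Re (q v v) - 2)" .
    moreover have "s * (cmod g)\<^sup>2 > 0" using s(1) neq by (simp add: g_def)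
    ultimately show False using s(2) by (simp add: zero_le_mult_iff)
  qed
  then show ?thesis using u(1) by blast
qed

end

section \<open>Continuity of the inner product, closures of subspaces, orthogonal
  projections\<close>

lemma semi_inner_form_cinner: "csubspace X \<Longrightarrow> semi_inner_form X cinner"
  by (rule semi_inner_form.intro, simp add: sesquilinear_form_def cinner_add_left cinner_add_right
      cinner_scaleC_left cinner_scaleC_right) (rule cinner_commute cinner_ge_zero)+

lemma csubspace_UNIV [simp]: "csubspace UNIV"
  by (simp add: csubspace_def)

lemma cmod_cinner_le: "cmod (cinner x y) \<le> norm x * norm y"
proof -
  interpret semi_inner_form UNIV "cinner :: 'a \<Rightarrow> 'a \<Rightarrow> complex"
    by (simp add: semi_inner_form_cinner)
  have "(cmod (cinner x y))\<^sup>2 \<le> (norm x * norm y)\<^sup>2"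
    using cauchy_schwarz[of x y] by (simp add: cinner_self power_mult_distrib)
  then show ?thesis by (rule power2_le_imp_le) simp
qed

lemma tendsto_cinner_left:
  assumes "(f \<longlongrightarrow> x) F"
  shows "((\<lambda>n. cinner (f n) y) \<longlongrightarrow> cinner x y) F"
proof -
  have lim: "((\<lambda>n. norm (f n - x) * norm y) \<longlongrightarrow> 0) F"
    by (rule tendsto_mult_left_zero[OF tendsto_norm_zero[OF LIM_zero[OF assms]]])
  have "((\<lambda>n. cinner (f n) y - cinner x y) \<longlongrightarrow> 0) F"
    by (rule Lim_null_comparison[OF always_eventually lim])
      (simp add: cmod_cinner_le flip: cinner_diff_left)
  then show ?thesis by (simp add: LIM_zero_iff)
qed

lemma tendsto_cinner_right:
  assumes "(f \<longlongrightarrow> x) F"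
  shows "((\<lambda>n. cinner y (f n)) \<longlongrightarrow> cinner y x) F"
  using tendsto_cnj[OF tendsto_cinner_left[OF assms, of y]] by (simp flip: cinner_commute)

lemma tendsto_scaleC_right:
  assumes "(f \<longlongrightarrow> x) F"
  shows "((\<lambda>n. c *\<^sub>C f n) \<longlongrightarrow> c *\<^sub>C x) F"
proof -
  have lim: "((\<lambda>n. cmod c * norm (f n - x)) \<longlongrightarrow> 0) F"
    by (rule tendsto_mult_right_zero[OF tendsto_norm_zero[OF LIM_zero[OF assms]]])
  have "((\<lambda>n. c *\<^sub>C f n - c *\<^sub>C x) \<longlongrightarrow> 0) F"
    by (rule Lim_null_comparison[OF always_eventually lim])
      (simp add: norm_scaleC flip: complex_vector.scale_right_diff_distrib)
  then show ?thesis by (simp add: LIM_zero_iff)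
qed

lemma csubspace_closure:
  assumes "csubspace X" shows "csubspace (closure X)"
  unfolding csubspace_def
proof (intro conjI ballI allI)
  show "0 \<in> closure X" using csubspaceD(1)[OF assms] closure_subset by blast
next
  fix x y assume "x \<in> closure X" "y \<in> closure X"
  then obtain f g where "\<And>n. f n \<in> X" "f \<longlonglongrightarrow> x" "\<And>n. g n \<in> X" "g \<longlonglongrightarrow> y"
    unfolding closure_sequential by blast
  then have "\<And>n. f n + g n \<in> X" "(\<lambda>n. f n + g n) \<longlonglongrightarrow> x + y"
    using csubspaceD(2)[OF assms] by (auto intro: tendsto_add)
  then show "x + y \<in> closure X" unfolding closure_sequential by (intro exI conjI) auto
next
  fix x c assume "x \<in> closure X"
  then obtain f where "\<And>n. f n \<in> X" "f \<longlonglongrightarrow> x"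
    unfolding closure_sequential by blast
  then have "\<And>n. c *\<^sub>C f n \<in> X" "(\<lambda>n. c *\<^sub>C f n) \<longlonglongrightarrow> c *\<^sub>C x"
    using csubspaceD(3)[OF assms] by (auto intro: tendsto_scaleC_right)
  then show "c *\<^sub>C x \<in> closure X" unfolding closure_sequential by (intro exI conjI) auto
qed

text \<open>The projection of x is the Riesz representative in V of the functional v |-> <x,v>;
  completeness in the form norm holds because V is closed in a complete space.\<close>

lemma orthogonal_projection_exists:
  fixes V :: "'a::chilbert_space set"
  assumes V: "csubspace V" "closed V"
  shows "\<exists>p\<in>V. \<forall>v\<in>V. cinner p v = cinner x v"
proof -
  interpret semi_inner_form V cinner by (rule semi_inner_form_cinner[OF V(1)])
  show ?thesis
  proof (rule riesz_representation[where C = "(norm x)\<^sup>2"])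
    fix f :: "nat \<Rightarrow> 'a"
    assume f: "\<And>n. f n \<in> V"
      and c: "\<forall>e>0. \<exists>N. \<forall>n\<ge>N. \<forall>m\<ge>N. Re (cinner (f n - f m) (f n - f m)) < e"
    have "Cauchy f"
    proof (rule CauchyI)
      fix e :: real assume e: "0 < e"
      then obtain N where "\<forall>n\<ge>N. \<forall>m\<ge>N. (norm (f n - f m))\<^sup>2 < e\<^sup>2"
        using c[rule_format, of "e\<^sup>2"] by (auto simp: cinner_self)
      then have "\<forall>n\<ge>N. \<forall>m\<ge>N. norm (f n - f m) < e"
        using e power2_less_imp_less[of _ e] by simp
      then show "\<exists>M. \<forall>m\<ge>M. \<forall>n\<ge>M. norm (f m - f n) < e" by blast
    qed
    then obtain u where u: "f \<longlonglongrightarrow> u" using Cauchy_convergent convergent_def by blast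
    moreover have "u \<in> V" using closed_sequentially[OF V(2)] f u by blast
    moreover have "(\<lambda>n. Re (cinner (f n - u) (f n - u))) \<longlonglongrightarrow> 0"
      using tendsto_power[OF tendsto_norm_zero[OF LIM_zero[OF u]], of 2] by (simp add: cinner_self)
    ultimately show "\<exists>u\<in>V. (\<lambda>n. Re (cinner (f n - u) (f n - u))) \<longlonglongrightarrow> 0" by blast
  next
    fix u assume "u \<in> V"
    show "(cmod (cinner x u))\<^sup>2 \<le> (norm x)\<^sup>2 * Re (cinner u u)"
      using power_mono[OF cmod_cinner_le[of x u], of 2] by (simp add: cinner_self power_mult_distrib)
  qed (auto simp: cinner_add_right cinner_scaleC_right)
qed

section \<open>Bounded self-adjoint operators\<close>

lemma cinner_ext:
  assumes "\<And>z. cinner x z = cinner y z" shows "x = y"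
proof -
  have "cinner (x - y) (x - y) = 0"
    by (simp add: assms cinner_diff_left)
  then show ?thesis by (simp add: cinner_eq_zero_iff)
qed

lemma norm_diff_sq:
  fixes x y :: "'a::complex_inner"
  shows "(norm (x - y))\<^sup>2 = (norm x)\<^sup>2 - 2 * Re (cinner x y) + (norm y)\<^sup>2"
proof -
  have sq: "(norm z)\<^sup>2 = Re (cinner z z)" for z :: 'a
    by (simp add: cinner_self)
  show ?thesis
    using cinner_commute[of y x] unfolding sq by (simp add: cinner_diff_left cinner_diff_right)
qed

text \<open>Linearity is not assumed: the adjoint identity forces it, since a vector is determined
  by its inner products. The bound is a parameter because shifts and squares carry their
  own.\<close>

locale selfadjoint_operator =
  fixes S :: "'a::complex_inner \<Rightarrow> 'a" and C :: real
  assumes adjoint: "cinner (S x) y = cinner x (S y)"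
    and bound: "norm (S x) \<le> C * norm x"
    and bound_nonneg: "0 \<le> C"
begin

lemma add: "S (x + y) = S x + S y"
  by (rule cinner_ext) (simp add: adjoint cinner_add_left)

lemma scale: "S (c *\<^sub>C x) = c *\<^sub>C S x"
  by (rule cinner_ext) (simp add: adjoint cinner_scaleC_left)

lemma diff: "S (x - y) = S x - S y"
  by (rule cinner_ext) (simp add: adjoint cinner_diff_left)

lemma tendsto:
  assumes "(f \<longlongrightarrow> x) F" shows "((\<lambda>n. S (f n)) \<longlongrightarrow> S x) F"
proof -
  have lim: "((\<lambda>n. C * norm (f n - x)) \<longlongrightarrow> 0) F"
    by (rule tendsto_mult_right_zero[OF tendsto_norm_zero[OF LIM_zero[OF assms]]])
  have "((\<lambda>n. S (f n) - S x) \<longlongrightarrow> 0) F"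
    by (rule Lim_null_comparison[OF always_eventually lim]) (simp add: bound flip: diff)
  then show ?thesis by (simp add: LIM_zero_iff)
qed

lemma subspace_image:
  assumes "csubspace X" shows "csubspace (S ` X)"
  unfolding csubspace_def
proof (intro conjI ballI allI)
  have "S 0 = 0" using scale[of 0 0] by simp
  then show "0 \<in> S ` X" using csubspaceD(1)[OF assms] by (metis imageI)
next
  fix x y assume "x \<in> S ` X" "y \<in> S ` X"
  then show "x + y \<in> S ` X" using csubspaceD(2)[OF assms] add by (auto simp flip: add)
next
  fix x c assume "x \<in> S ` X"
  then show "c *\<^sub>C x \<in> S ` X" using csubspaceD(3)[OF assms] by (auto simp flip: scale)
qed

lemma semi_inner_form_op:
  assumes "csubspace X" "\<And>u. u \<in> X \<Longrightarrow> 0 \<le> Re (cinner (S u) u)"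
  shows "semi_inner_form X (\<lambda>u v. cinner (S u) v)"
proof
  show "sesquilinear_form X (\<lambda>u v. cinner (S u) v)"
    by (simp add: sesquilinear_form_def assms(1) add scale cinner_add_left cinner_add_right
        cinner_scaleC_left cinner_scaleC_right)
  show "cinner (S v) u = cnj (cinner (S u) v)" for u v
    by (metis adjoint cinner_commute)
qed (rule assms(2))

text \<open>Cauchy-Schwarz for the form <S u, v> at v = S u gives |Su|^4 <= <Su,u> <SSu,Su>, and the
  last factor is at most C |Su|^2.\<close>

lemma norm_sq_le:
  assumes X: "csubspace X" "S ` X \<subseteq> X" and pos: "\<And>u. u \<in> X \<Longrightarrow> 0 \<le> Re (cinner (S u) u)"
    and u: "u \<in> X"
  shows "(norm (S u))\<^sup>2 \<le> C * Re (cinner (S u) u)"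
proof (cases "S u = 0")
  case False
  interpret semi_inner_form X "\<lambda>u v. cinner (S u) v"
    by (rule semi_inner_form_op[OF X(1) pos])
  have Su: "S u \<in> X" using X(2) u by blast
  have "Re (cinner (S (S u)) (S u)) \<le> norm (S (S u)) * norm (S u)"
    using complex_Re_le_cmod cmod_cinner_le order_trans by metis
  also have "\<dots> \<le> C * norm (S u) * norm (S u)"
    by (intro mult_right_mono bound) auto
  finally have "Re (cinner (S (S u)) (S u)) \<le> C * (norm (S u))\<^sup>2"
    by (simp add: power2_eq_square mult.assoc)
  then have "Re (cinner (S u) u) * Re (cinner (S (S u)) (S u)) \<le> Re (cinner (S u) u) * (C * (norm (S u))\<^sup>2)"
    by (rule mult_left_mono) (rule pos[OF u])
  then have "((norm (S u))\<^sup>2)\<^sup>2 \<le> Re (cinner (S u) u) * (C * (norm (S u))\<^sup>2)"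
    using cauchy_schwarz[OF u Su] by (simp add: cinner_self norm_power del: of_real_power)
  then have "(norm (S u))\<^sup>2 * (norm (S u))\<^sup>2 \<le> (C * Re (cinner (S u) u)) * (norm (S u))\<^sup>2"
    by (simp add: power2_eq_square mult_ac)
  then show ?thesis
    using False by (subst (asm) mult_le_cancel_right) auto
qed (use bound_nonneg pos[OF u] in auto)

text \<open>Since |Su|^2 <= C <Su,u>, a lower bound in norm becomes a lower bound for the quadratic
  form.\<close>

lemma coercive:
  assumes X: "csubspace X" "S ` X \<subseteq> X" and pos: "\<And>u. u \<in> X \<Longrightarrow> 0 \<le> Re (cinner (S u) u)"
    and e: "e > 0" "\<And>u. u \<in> X \<Longrightarrow> e * norm u \<le> norm (S u)"
  shows "\<exists>d>0. \<forall>u\<in>X. d * (norm u)\<^sup>2 \<le> Re (cinner (S u) u)"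
proof (intro exI conjI ballI)
  \<comment> \<open>\<open>C\<close> may be 0, hence the denominator C + 1.\<close>
  show "e\<^sup>2 / (C + 1) > 0" using e bound_nonneg by simp
  fix u assume u: "u \<in> X"
  have "(e * norm u)\<^sup>2 \<le> (norm (S u))\<^sup>2"
    using e u by (intro power_mono) auto
  also have "\<dots> \<le> C * Re (cinner (S u) u)" by (rule norm_sq_le[OF X pos u])
  also have "\<dots> \<le> (C + 1) * Re (cinner (S u) u)"
    using pos[OF u] by (simp add: algebra_simps)
  finally show "e\<^sup>2 / (C + 1) * (norm u)\<^sup>2 \<le> Re (cinner (S u) u)"
    using bound_nonneg by (simp add: field_simps power_mult_distrib)
qed

lemma shift: "selfadjoint_operator (\<lambda>u. S u - complex_of_real c *\<^sub>C u) (C + \<bar>c\<bar>)"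
proof
  fix x y
  show "cinner (S x - complex_of_real c *\<^sub>C x) y = cinner x (S y - complex_of_real c *\<^sub>C y)"
    by (simp add: cinner_diff_left cinner_diff_right cinner_scaleC_left cinner_scaleC_right adjoint)
  have "norm (S x - complex_of_real c *\<^sub>C x) \<le> norm (S x) + norm (complex_of_real c *\<^sub>C x)"
    by (rule norm_triangle_ineq4)
  then show "norm (S x - complex_of_real c *\<^sub>C x) \<le> (C + \<bar>c\<bar>) * norm x"
    using bound[of x] by (simp add: norm_scaleC algebra_simps)
qed (use bound_nonneg in auto)

lemma square: "selfadjoint_operator (\<lambda>u. S (S u)) (C * C)"
proof
  fix x
  have "norm (S (S x)) \<le> C * norm (S x)" by (rule bound)
  also have "\<dots> \<le> C * (C * norm x)" by (intro mult_left_mono bound bound_nonneg)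
  finally show "norm (S (S x)) \<le> C * C * norm x" by (simp add: mult.assoc)
qed (use bound_nonneg adjoint in auto)

text \<open>If \<open>r\<close> is the minimum modulus of \<open>S\<close> on \<open>X\<close>, then \<open>(S - r)(S + r) = S\<^sup>2 - r\<^sup>2\<close> is
  nonnegative but not coercive there, so one of the two factors is not bounded below.\<close>
lemma gap:
  assumes X: "csubspace X" "S ` X \<subseteq> X" and s: "s \<ge> 0"
    and below: "\<And>r. \<bar>r\<bar> < s \<Longrightarrow> \<exists>e>0. \<forall>u\<in>X. e * norm u \<le> norm (S u - complex_of_real r *\<^sub>C u)"
    and u: "u \<in> X"
  shows "s * norm u \<le> norm (S u)"
proof (rule ccontr)
  assume contr: "\<not> ?thesis"
  define Q where "Q = (\<lambda>v. (norm (S v) / norm v)\<^sup>2) ` (X - {0})"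
  define r where "r = sqrt (Inf Q)"
  have u0: "u \<noteq> 0" using contr by auto
  have Q: "Q \<noteq> {}" "bdd_below Q"
    using u u0 by (auto simp: Q_def intro!: bdd_belowI2[of _ 0])
  have Inf0: "0 \<le> Inf Q" using Q(1) by (intro cInf_greatest) (auto simp: Q_def)
  have r: "0 \<le> r" "r\<^sup>2 = Inf Q" using Inf0 by (auto simp: r_def)
  have "Inf Q \<le> (norm (S u) / norm u)\<^sup>2"
    using u u0 by (intro cInf_lower Q) (auto simp: Q_def)
  also have "\<dots> < s\<^sup>2" using contr u0 s
    by (intro power_strict_mono) (auto simp: field_simps)
  finally have "r < s" using r s by (metis power_less_imp_less_base)
  then obtain e1 e2 where e: "e1 > 0" "\<And>v. v \<in> X \<Longrightarrow> e1 * norm v \<le> norm (S v - complex_of_real r *\<^sub>C v)"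
      "e2 > 0" "\<And>v. v \<in> X \<Longrightarrow> e2 * norm v \<le> norm (S v - complex_of_real (- r) *\<^sub>C v)"
    using below[of r] below[of "- r"] r(1) by auto
  define N where "N v = S (S v) - complex_of_real (r\<^sup>2) *\<^sub>C v" for v
  interpret N: selfadjoint_operator N "C * C + \<bar>r\<^sup>2\<bar>"
    unfolding N_def[abs_def] by (rule selfadjoint_operator.shift[OF square])
  have ReN: "Re (cinner (N v) v) = (norm (S v))\<^sup>2 - r\<^sup>2 * (norm v)\<^sup>2" for v
  proof -
    have "cinner (N v) v = cinner (S v) (S v) - complex_of_real (r\<^sup>2) * cinner v v"
      by (simp only: N_def cinner_diff_left cinner_scaleC_left adjoint)
    then show ?thesis by (simp add: cinner_self del: of_real_power)
  qed
  have posN: "0 \<le> Re (cinner (N v) v)" if "v \<in> X" for v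
  proof (cases "v = 0")
    case False
    then have "r\<^sup>2 \<le> (norm (S v) / norm v)\<^sup>2"
      unfolding r(2) using that by (intro cInf_lower Q) (auto simp: Q_def)
    then show ?thesis using False by (simp add: ReN power_divide field_simps)
  qed simp
  have NX: "N ` X \<subseteq> X"
    using X csubspaceD[OF X(1)] by (auto simp: N_def image_subset_iff)
  \<comment> \<open>Both r and -r lie in the window (-s, s), so both factors are bounded below. Then
    so is their product, and a nonnegative operator bounded below is coercive.\<close>
  have "\<exists>d>0. \<forall>v\<in>X. d * (norm v)\<^sup>2 \<le> Re (cinner (N v) v)"
  proof (rule N.coercive[OF X(1) NX posN])
    show "e1 * e2 > 0" using e by simp
    fix v assume v: "v \<in> X"
    define y where "y = S v - complex_of_real (- r) *\<^sub>C v"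
    have y: "y \<in> X" using v X csubspaceD[OF X(1)] by (auto simp: y_def image_subset_iff)
    have "N v = S y - complex_of_real r *\<^sub>C y"
      by (simp add: N_def y_def add scale diff complex_vector.scale_right_distrib power2_eq_square)
    then have "e1 * norm y \<le> norm (N v)" using e(2)[OF y] by simp
    moreover have "e1 * (e2 * norm v) \<le> e1 * norm y"
      using e(1) e(4)[OF v] by (intro mult_left_mono) (auto simp: y_def)
    ultimately show "e1 * e2 * norm v \<le> norm (N v)" by (simp add: mult.assoc)
  qed
  then obtain d where d: "d > 0" "\<And>v. v \<in> X \<Longrightarrow> d * (norm v)\<^sup>2 \<le> Re (cinner (N v) v)"
    by blast
  \<comment> \<open>Coercivity of S^2 - r^2 lifts the infimum r^2 by d, which is absurd.\<close>
  have "r\<^sup>2 + d \<le> Inf Q"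
  proof (rule cInf_greatest[OF Q(1)])
    fix z assume "z \<in> Q"
    then obtain v where v: "v \<in> X" "v \<noteq> 0" "z = (norm (S v) / norm v)\<^sup>2"
      by (auto simp: Q_def)
    then show "r\<^sup>2 + d \<le> z"
      using d(2)[OF v(1)] by (simp add: ReN power_divide le_divide_eq algebra_simps)
  qed
  then show False using d(1) r(2) by simp
qed

end

section \<open>The top of the numerical range on an invariant subspace\<close>

locale selfadjoint_operator_hilbert = selfadjoint_operator S C
  for S :: "'a::chilbert_space \<Rightarrow> 'a" and C
begin

text \<open>The top of the numerical range on \<open>X\<close> would be isolated from the rest of the spectrum,
  hence an eigenvalue.\<close>
lemma upper_bound_on_invariant_subspace:
  assumes X: "csubspace X" "closed X" "S ` X \<subseteq> X" and K: "finite K"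
    and below: "\<And>k. \<kappa> < k \<Longrightarrow> k \<notin> K \<Longrightarrow>
        \<exists>e>0. \<forall>u\<in>X. e * norm u \<le> norm (S u - complex_of_real k *\<^sub>C u)"
    and no_eigen: "\<And>k u. \<kappa> < k \<Longrightarrow> u \<in> X \<Longrightarrow> S u = complex_of_real k *\<^sub>C u \<Longrightarrow> u = 0"
    and u: "u \<in> X"
  shows "Re (cinner (S u) u) \<le> \<kappa> * (norm u)\<^sup>2"
proof (rule ccontr)
  assume contr: "\<not> ?thesis"
  define Q where "Q = (\<lambda>v. Re (cinner (S v) v) / (norm v)\<^sup>2) ` (X - {0})"
  define k where "k = Sup Q"
  have u0: "u \<noteq> 0" using contr by auto
  have Re_le: "Re (cinner (S v) v) \<le> C * (norm v)\<^sup>2" for v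
  proof -
    have "Re (cinner (S v) v) \<le> norm (S v) * norm v"
      using complex_Re_le_cmod cmod_cinner_le order_trans by metis
    also have "\<dots> \<le> C * norm v * norm v" by (intro mult_right_mono bound) auto
    finally show ?thesis by (simp add: power2_eq_square mult.assoc)
  qed
  have Q: "Q \<noteq> {}" "bdd_above Q"
  proof -
    have "Re (cinner (S v) v) / (norm v)\<^sup>2 \<le> C" if "v \<noteq> 0" for v
      using Re_le[of v] that by (simp add: pos_divide_le_eq)
    then show "bdd_above Q" unfolding Q_def by (intro bdd_aboveI2) auto
  qed (use u u0 in \<open>auto simp: Q_def\<close>)
  have "\<kappa> < Re (cinner (S u) u) / (norm u)\<^sup>2" using contr u0 by (simp add: field_simps)
  also have "\<dots> \<le> k" unfolding k_def using u u0 by (intro cSup_upper Q) (auto simp: Q_def)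
  finally have kappa: "\<kappa> < k" .
  have le_k: "Re (cinner (S v) v) \<le> k * (norm v)\<^sup>2" if "v \<in> X" for v
  proof (cases "v = 0")
    case False
    then have "Re (cinner (S v) v) / (norm v)\<^sup>2 \<le> k"
      unfolding k_def using that by (intro cSup_upper Q) (auto simp: Q_def)
    then show ?thesis using False by (simp add: field_simps)
  qed simp
  \<comment> \<open>The last exceptional point below \<open>k\<close>, or \<kappa> if none lies
    above \<kappa>: S - r is bounded below on X for every r in (m, k). The point \<open>k\<close>
    itself may belong to \<open>K\<close>.\<close>
  define m where "m = Max (insert \<kappa> {j \<in> K. j < k})"
  have m: "m < k" "\<kappa> \<le> m" "\<And>j. j \<in> K \<Longrightarrow> j < k \<Longrightarrow> j \<le> m"
    using K kappa by (auto simp: m_def)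
  define s where "s = k - m"
  define c where "c = (m + k) / 2"
  have s: "s > 0" using m by (simp add: s_def)
  \<comment> \<open>Seen from the midpoint \<open>c\<close>, the interval (m, k) is a symmetric
    window of radius s/2, as the minimum modulus argument requires.\<close>
  have gap: "s / 2 * norm v \<le> norm (S v - complex_of_real c *\<^sub>C v)" if "v \<in> X" for v
  proof (rule selfadjoint_operator.gap[OF shift X(1)])
    show "(\<lambda>u. S u - complex_of_real c *\<^sub>C u) ` X \<subseteq> X"
      using X csubspaceD[OF X(1)] by (auto simp: image_subset_iff)
    fix r assume "\<bar>r\<bar> < s / 2"
    then have "m < c + r" "c + r < k" by (auto simp: s_def c_def field_simps)
    then have "\<exists>e>0. \<forall>u\<in>X. e * norm u \<le> norm (S u - complex_of_real (c + r) *\<^sub>C u)"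
      using m by (intro below) force+
    then show "\<exists>e>0. \<forall>u\<in>X. e * norm u \<le>
        norm (S u - complex_of_real c *\<^sub>C u - complex_of_real r *\<^sub>C u)"
      by (simp add: complex_vector.scale_left_distrib diff_diff_eq)
  qed (use s that in auto)
  define T where "T v = complex_of_real k *\<^sub>C v - S v" for v
  interpret T: selfadjoint_operator T "C + \<bar>k\<bar>"
  proof
    show "cinner (T x) y = cinner x (T y)" for x y
      by (simp add: T_def cinner_diff_left cinner_diff_right cinner_scaleC_left
          cinner_scaleC_right adjoint)
    show "norm (T x) \<le> (C + \<bar>k\<bar>) * norm x" for x
      using selfadjoint_operator.bound[OF shift[of k], of x] by (simp add: T_def norm_minus_commute)
  qed (use bound_nonneg in auto)
  have ReT: "Re (cinner (T v) v) = k * (norm v)\<^sup>2 - Re (cinner (S v) v)" for v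
    by (simp add: T_def cinner_diff_left cinner_scaleC_left cinner_self del: of_real_power)
  \<comment> \<open>Squaring the gap estimate cancels |(s/2) v|^2 on both sides. What remains is T^2
    >= s T in the sense of forms on X, expressing a spectral gap (0, s) of T = k - S.\<close>
  have T_sq: "s * Re (cinner (T v) v) \<le> (norm (T v))\<^sup>2" if "v \<in> X" for v
  proof -
    have c: "S v - complex_of_real c *\<^sub>C v = complex_of_real (s / 2) *\<^sub>C v - T v"
    proof -
      have "c = k - s / 2" by (simp add: c_def s_def field_simps)
      then have "complex_of_real c *\<^sub>C v = complex_of_real k *\<^sub>C v - complex_of_real (s / 2) *\<^sub>C v"
        by (simp add: complex_vector.scale_left_diff_distrib)
      then show ?thesis by (simp add: T_def)
    qed
    have "(s / 2 * norm v)\<^sup>2 \<le> (norm (complex_of_real (s / 2) *\<^sub>C v - T v))\<^sup>2"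
      using gap[OF that] s unfolding c by (intro power_mono) auto
    also have "\<dots> = (s / 2 * norm v)\<^sup>2 - s * Re (cinner (T v) v) + (norm (T v))\<^sup>2"
      using s by (simp add: norm_diff_sq norm_scaleC cinner_scaleC_left cinner_commute[of v "T v"]
          flip: of_real_divide)
    finally show ?thesis by simp
  qed
  have posT: "0 \<le> Re (cinner (T v) v)" if "v \<in> X" for v
    using le_k[OF that] by (simp add: ReT)
  have TX: "T v \<in> X" if "v \<in> X" for v
    using X that csubspaceD[OF X(1)] by (auto simp: T_def image_subset_iff)
  interpret semi_inner_form X "\<lambda>u v. cinner (T u) v"
    by (rule T.semi_inner_form_op[OF X(1) posT])
  \<comment> \<open>On the range one factor T can be cancelled: for v = T y, Cauchy-Schwarz for <T
    u, v> gives |v|^4 <= <Tv,v> <Ty,y>, while s <Ty,y> <= |v|^2.\<close>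
  have on_range: "s * (norm v)\<^sup>2 \<le> Re (cinner (T v) v)" if v: "v \<in> T ` X" for v
  proof (cases "v = 0")
    case False
    obtain y where y: "y \<in> X" "v = T y" using v by blast
    have vX: "v \<in> X" using y TX by blast
    have "cinner (T v) y = cinner v v" unfolding y(2) by (rule T.adjoint)
    then have "((norm v)\<^sup>2)\<^sup>2 \<le> Re (cinner (T v) v) * Re (cinner (T y) y)"
      using cauchy_schwarz[OF vX y(1)] by (simp add: cinner_self norm_power del: of_real_power)
    then have "s * ((norm v)\<^sup>2)\<^sup>2 \<le> Re (cinner (T v) v) * (s * Re (cinner (T y) y))"
      using s by (simp add: mult.left_commute)
    also have "\<dots> \<le> Re (cinner (T v) v) * (norm v)\<^sup>2"
      using T_sq[OF y(1)] posT[OF vX] unfolding y(2) by (rule mult_left_mono)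
    finally have "(s * (norm v)\<^sup>2) * (norm v)\<^sup>2 \<le> Re (cinner (T v) v) * (norm v)\<^sup>2"
      by (simp add: power2_eq_square mult_ac)
    then show ?thesis using False by (subst (asm) mult_le_cancel_right) auto
  qed simp
  \<comment> \<open>A vector of X orthogonal to the range is annihilated by T. It would be an
    eigenvector of S for \<open>k\<close>, which \<open>no_eigen\<close> excludes, so it is
    zero.\<close>
  have dense: "x \<in> closure (T ` X)" if x: "x \<in> X" for x
  proof -
    obtain p where p: "p \<in> closure (T ` X)" "\<And>v. v \<in> closure (T ` X) \<Longrightarrow> cinner p v = cinner x v"
      using orthogonal_projection_exists[OF csubspace_closure[OF T.subspace_image[OF X(1)]] closed_closure]
      by blast
    have "closure (T ` X) \<subseteq> X" using TX X(2) by (intro closure_minimal) auto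
    then have y: "x - p \<in> X" using p(1) x closed_under(4) by blast
    have "cinner (T (x - p)) (T (x - p)) = cinner (x - p) (T (T (x - p)))"
      by (rule T.adjoint)
    also have "\<dots> = 0"
      using p(2)[OF subsetD[OF closure_subset imageI[OF TX[OF y]]]] by (simp add: cinner_diff_left)
    finally have "T (x - p) = 0" by (simp add: cinner_eq_zero_iff)
    then have "x - p = 0" using no_eigen[OF kappa y] by (simp add: T_def)
    then show ?thesis using p(1) by simp
  qed
  have on_X: "s * (norm v)\<^sup>2 \<le> Re (cinner (T v) v)" if v: "v \<in> X" for v
  proof -
    obtain f where f: "\<And>n. f n \<in> T ` X" "f \<longlonglongrightarrow> v"
      using dense[OF v] unfolding closure_sequential by blast
    have lim: "(\<lambda>n. s * (norm (f n))\<^sup>2) \<longlonglongrightarrow> s * (norm v)\<^sup>2" by (intro tendsto_intros f)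
    \<comment> \<open>Both arguments of the quadratic form move at once: it is expanded around v,
      and this remainder tends to 0.\<close>
    have "(\<lambda>n. cinner (T (f n) - T v) (f n - v)) \<longlonglongrightarrow> 0"
    proof (rule Lim_null_comparison[OF always_eventually])
      show "\<forall>n. cmod (cinner (T (f n) - T v) (f n - v)) \<le> norm (T (f n) - T v) * norm (f n - v)"
        by (simp add: cmod_cinner_le)
      show "(\<lambda>n. norm (T (f n) - T v) * norm (f n - v)) \<longlonglongrightarrow> 0"
        using tendsto_mult[OF tendsto_norm_zero[OF LIM_zero[OF T.tendsto[OF f(2)]]] tendsto_norm_zero[OF LIM_zero[OF f(2)]]]
        by simp
    qed
    then have "(\<lambda>n. cinner (T (f n) - T v) (f n - v) + cinner (T (f n)) v + cinner (T v) (f n) - cinner (T v) v)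
        \<longlonglongrightarrow> 0 + cinner (T v) v + cinner (T v) v - cinner (T v) v"
      by (intro tendsto_intros tendsto_cinner_left tendsto_cinner_right T.tendsto f(2))
    then have "(\<lambda>n. cinner (T (f n)) (f n)) \<longlonglongrightarrow> cinner (T v) v"
      by (simp add: cinner_diff_left cinner_diff_right)
    then have "(\<lambda>n. Re (cinner (T (f n)) (f n))) \<longlonglongrightarrow> Re (cinner (T v) v)"
      by (rule tendsto_Re)
    from LIMSEQ_le[OF lim this] show ?thesis using on_range[OF f(1)] by auto
  qed
  \<comment> \<open>Now <Sv,v> <= (k - s) |v|^2 = m |v|^2 on X, so the supremum \<open>k\<close> is
    at most \<open>m\<close>.\<close>
  have "k \<le> m"
    unfolding k_def
  proof (rule cSup_least[OF Q(1)])
    fix z assume "z \<in> Q"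
    then obtain v where v: "v \<in> X" "v \<noteq> 0" "z = Re (cinner (S v) v) / (norm v)\<^sup>2"
      by (auto simp: Q_def)
    have "s * (norm v)\<^sup>2 \<le> k * (norm v)\<^sup>2 - Re (cinner (S v) v)"
      using on_X[OF v(1)] by (simp add: ReT)
    then show "z \<le> m" using v by (simp add: s_def pos_divide_le_eq algebra_simps)
  qed
  then show False using m(1) by simp
qed

end

section \<open>Resolvents of closed symmetric forms\<close>

definition orthonormal :: "'a::complex_inner set \<Rightarrow> bool" where
  "orthonormal E \<longleftrightarrow> (\<forall>x\<in>E. \<forall>y\<in>E. cinner x y = (if x = y then 1 else 0))"

lemma orthonormalD:
  assumes "orthonormal E" "x \<in> E" "y \<in> E"
  shows "cinner x y = (if x = y then 1 else 0)"
  using assms by (auto simp: orthonormal_def)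

lemma orthonormal_norm: "orthonormal E \<Longrightarrow> x \<in> E \<Longrightarrow> norm x = 1"
  by (simp add: norm_eq_sqrt_cinner orthonormalD)

lemma cinner_orthonormal_sum:
  assumes "finite E" "orthonormal E" "e \<in> E"
  shows "cinner (\<Sum>x\<in>E. c x *\<^sub>C x) e = c e"
proof -
  have "cinner (\<Sum>x\<in>E. c x *\<^sub>C x) e = (\<Sum>x\<in>E. if x = e then c x else 0)"
    unfolding cinner_sum_left
    by (intro sum.cong) (auto simp: cinner_scaleC_left orthonormalD[OF assms(2) _ assms(3)])
  then show ?thesis using assms by simp
qed

text \<open>For the projection p of x onto the span, <x,p> and <p,p> both equal the sum, so |p|^2 <=
  |x| |p|.\<close>

lemma bessel:
  assumes "finite E" "orthonormal E"
  shows "(\<Sum>e\<in>E. (cmod (cinner x e))\<^sup>2) \<le> (norm x)\<^sup>2"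
proof -
  define p where "p = (\<Sum>e\<in>E. cinner x e *\<^sub>C e)"
  let ?S = "\<Sum>e\<in>E. (cmod (cinner x e))\<^sup>2"
  have "cinner y p = of_real ?S" if "\<And>e. e \<in> E \<Longrightarrow> cinner y e = cinner x e" for y
    unfolding p_def cinner_sum_right
    by (simp add: cinner_scaleC_right that complex_norm_square mult.commute del: of_real_power)
  moreover have "\<And>e. e \<in> E \<Longrightarrow> cinner p e = cinner x e"
    unfolding p_def by (rule cinner_orthonormal_sum[OF assms])
  ultimately have "of_real ?S = cinner x p" "cinner p p = of_real ?S"
    by auto
  moreover then have S: "?S = (norm p)\<^sup>2"
    by (metis cinner_self of_real_eq_iff)
  ultimately have "(norm p)\<^sup>2 \<le> norm x * norm p"
    using cmod_cinner_le[of x p] complex_Re_le_cmod[of "cinner x p"] by (metis Re_complex_of_real order_trans)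
  then have "norm p \<le> norm x"
    by (cases "norm p = 0") (auto simp: power2_eq_square)
  then show ?thesis using S by (simp add: power_mono)
qed

text \<open>Density makes the vector f in the definition of the associated operator unique, so that
  the \<open>THE\<close> in \<open>assoc_op\<close> denotes it.\<close>

lemma cinner_eqI_dense:
  assumes "densely_defined D" "\<And>v. v \<in> D \<Longrightarrow> cinner f v = cinner g v"
  shows "f = g"
proof -
  have "f - g \<in> closure D" using assms(1) by (simp add: densely_defined_def)
  then obtain s where s: "\<And>n. s n \<in> D" "s \<longlonglongrightarrow> f - g"
    unfolding closure_sequential by blast
  have "cinner (s n) (f - g) = 0" for n
    using assms(2)[OF s(1)[of n]] cinner_commute[of "s n" "f - g"] by (simp add: cinner_diff_left)
  then have "cinner (f - g) (f - g) = 0"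
    using tendsto_cinner_left[OF s(2), of "f - g"] by (simp add: LIMSEQ_const_iff)
  then show ?thesis by (simp add: cinner_eq_zero_iff)
qed

lemma assoc_opI:
  assumes "densely_defined D" "u \<in> D" "\<And>v. v \<in> D \<Longrightarrow> a u v = cinner f v"
  shows "u \<in> assoc_dom D a" "assoc_op D a u = f"
proof -
  show "u \<in> assoc_dom D a" using assms by (auto simp: assoc_dom_def)
  show "assoc_op D a u = f" unfolding assoc_op_def
  proof (rule the_equality)
    fix g assume "\<forall>v\<in>D. a u v = cinner g v"
    then show "g = f" using assms by (intro cinner_eqI_dense[OF assms(1)]) auto
  qed (use assms in auto)
qed

lemma assoc_opD:
  assumes "densely_defined D" "u \<in> assoc_dom D a"
  shows "u \<in> D" "v \<in> D \<Longrightarrow> a u v = cinner (assoc_op D a u) v"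
proof -
  obtain f where f: "u \<in> D" "\<And>v. v \<in> D \<Longrightarrow> a u v = cinner f v"
    using assms(2) by (auto simp: assoc_dom_def)
  show "u \<in> D" by (rule f)
  show "v \<in> D \<Longrightarrow> a u v = cinner (assoc_op D a u) v"
    using f assoc_opI(2)[where a = a, OF assms(1) f] by simp
qed

text \<open>The shift \<open>w\<close> is large enough for h + w >= 1: the form norm dominates the
  Hilbert norm, the resolvent has norm at most 1, and w - \<delta> > 0 for \<delta> < 1. Closedness
  appears as completeness in the form norm, which is what the Riesz argument consumes.\<close>

locale closed_symmetric_form =
  fixes D :: "'a::chilbert_space set" and h :: "'a \<Rightarrow> 'a \<Rightarrow> complex" and w :: real
  assumes sesquilinear: "sesquilinear_form D h"
    and symmetric: "u \<in> D \<Longrightarrow> v \<in> D \<Longrightarrow> h v u = cnj (h u v)"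
    and dense: "densely_defined D"
    and w_ge_1: "1 \<le> w"
    and lower: "u \<in> D \<Longrightarrow> (norm u)\<^sup>2 \<le> Re (h u u) + w * (norm u)\<^sup>2"
    and complete: "\<And>x::nat \<Rightarrow> 'a. (\<And>n. x n \<in> D) \<Longrightarrow>
      (\<forall>e>0. \<exists>N. \<forall>n\<ge>N. \<forall>m\<ge>N. Re (h (x n - x m) (x n - x m)) + w * (norm (x n - x m))\<^sup>2 < e) \<Longrightarrow>
      \<exists>u\<in>D. (\<lambda>n. Re (h (x n - u) (x n - u)) + w * (norm (x n - u))\<^sup>2) \<longlonglongrightarrow> 0"
begin

definition q :: "'a \<Rightarrow> 'a \<Rightarrow> complex" where
  "q u v = h u v + complex_of_real w * cinner u v"

lemma Re_q: "Re (q u u) = Re (h u u) + w * (norm u)\<^sup>2"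
  by (simp add: q_def cinner_self del: of_real_power)

sublocale q: semi_inner_form D q
proof
  show "sesquilinear_form D q"
    using sesquilinear
    by (simp add: sesquilinear_form_def q_def cinner_add_left cinner_add_right cinner_scaleC_left
        cinner_scaleC_right algebra_simps)
  show "q v u = cnj (q u v)" if "u \<in> D" "v \<in> D" for u v
    using symmetric[OF that] cinner_commute[of v u] by (simp add: q_def)
  show "0 \<le> Re (q u u)" if "u \<in> D" for u
    using order_trans[OF zero_le_power2 lower[OF that]] by (simp add: Re_q)
qed

lemma norm_sq_le_q: "u \<in> D \<Longrightarrow> (norm u)\<^sup>2 \<le> Re (q u u)"
  using lower by (simp add: Re_q)

abbreviation H where "H \<equiv> assoc_op D h"
abbreviation domH where "domH \<equiv> assoc_dom D h"

definition R :: "'a \<Rightarrow> 'a" where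
  "R f = (SOME u. u \<in> D \<and> (\<forall>v\<in>D. q u v = cinner f v))"

lemma R: "R f \<in> D" "v \<in> D \<Longrightarrow> q (R f) v = cinner f v"
proof -
  have "\<exists>u\<in>D. \<forall>v\<in>D. q u v = cinner f v"
  proof (rule q.riesz_representation[where C = "(norm f)\<^sup>2"])
    fix u assume u: "u \<in> D"
    have "(cmod (cinner f u))\<^sup>2 \<le> (norm f)\<^sup>2 * (norm u)\<^sup>2"
      using power_mono[OF cmod_cinner_le[of f u], of 2] by (simp add: power_mult_distrib)
    also have "\<dots> \<le> (norm f)\<^sup>2 * Re (q u u)"
      by (intro mult_left_mono norm_sq_le_q u) auto
    finally show "(cmod (cinner f u))\<^sup>2 \<le> (norm f)\<^sup>2 * Re (q u u)" .
  qed (use complete in \<open>auto simp: Re_q cinner_add_right cinner_scaleC_right\<close>)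
  then have "\<exists>u. u \<in> D \<and> (\<forall>v\<in>D. q u v = cinner f v)" by blast
  from someI_ex[OF this] have "R f \<in> D \<and> (\<forall>v\<in>D. q (R f) v = cinner f v)"
    unfolding R_def .
  then show "R f \<in> D" "v \<in> D \<Longrightarrow> q (R f) v = cinner f v" by auto
qed

lemma R_unique:
  assumes "u \<in> D" "\<And>v. v \<in> D \<Longrightarrow> q u v = cinner f v"
  shows "R f = u"
proof -
  have d: "R f - u \<in> D" by (rule q.closed_under(4)[OF R(1) assms(1)])
  have "q (R f - u) (R f - u) = 0"
    using sesquilinear_form_diff(1)[OF q.form R(1) assms(1) d] assms(2)[OF d] R(2)[OF d] by simp
  then show ?thesis using norm_sq_le_q[OF d] by simp
qed

text \<open>The weak equation solved by \<open>R f\<close> reads (H + w) R f = f. Hence r in the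
  spectrum of \<open>H\<close> is to be matched with 1 / (r + w) for \<open>R\<close>.\<close>

lemma H_R: "R f \<in> domH" "H (R f) = f - complex_of_real w *\<^sub>C R f"
proof -
  have "h (R f) v = cinner (f - complex_of_real w *\<^sub>C R f) v" if "v \<in> D" for v
    using R(2)[OF that, of f] by (simp add: q_def cinner_diff_left cinner_scaleC_left algebra_simps)
  from assoc_opI[where a = h, OF dense R(1) this]
  show "R f \<in> domH" "H (R f) = f - complex_of_real w *\<^sub>C R f" by auto
qed

lemma R_eigenvector:
  assumes u: "u \<in> domH" "H u = complex_of_real r *\<^sub>C u"
  shows "complex_of_real (r + w) *\<^sub>C R u = u"
proof -
  have uD: "u \<in> D" using assoc_opD(1)[OF dense u(1)] .
  have "R (complex_of_real (r + w) *\<^sub>C u) = u"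
    by (rule R_unique[OF uD])
      (simp add: q_def assoc_opD(2)[OF dense u(1)] u(2) cinner_scaleC_left cinner_add_left algebra_simps)
  moreover have "R (complex_of_real (r + w) *\<^sub>C u) = complex_of_real (r + w) *\<^sub>C R u"
    by (rule R_unique)
      (auto simp: R q.closed_under sesquilinear_formD(3)[OF q.form] cinner_scaleC_left)
  ultimately show ?thesis by simp
qed

text \<open>The lower bound of the form, tested on the eigenvector. It keeps 1 / (r + w) well
  defined and positive.\<close>

lemma eigenvalue_gt:
  assumes u: "u \<in> domH" "H u = complex_of_real r *\<^sub>C u" "u \<noteq> 0"
  shows "1 \<le> r + w"
proof -
  have uD: "u \<in> D" using assoc_opD(1)[OF dense u(1)] .
  have "h u u = complex_of_real r * cinner u u"
    using assoc_opD(2)[OF dense u(1) uD] u(2) by (simp add: cinner_scaleC_left)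
  then have "Re (h u u) = r * (norm u)\<^sup>2" by (simp add: cinner_self del: of_real_power)
  then have "1 * (norm u)\<^sup>2 \<le> (r + w) * (norm u)\<^sup>2"
    using lower[OF uD] by (simp add: algebra_simps)
  then show ?thesis using u(3) by (subst (asm) mult_le_cancel_right) auto
qed

sublocale R: selfadjoint_operator_hilbert R 1
proof unfold_locales
  fix x y
  have "cinner (R x) y = cnj (cinner y (R x))" by (rule cinner_commute)
  also have "\<dots> = cnj (q (R y) (R x))" using R by simp
  also have "\<dots> = q (R x) (R y)" using q.hermitian R by metis
  also have "\<dots> = cinner x (R y)" using R by simp
  finally show "cinner (R x) y = cinner x (R y)" .
  have "(norm (R x))\<^sup>2 \<le> Re (cinner x (R x))"
    using norm_sq_le_q[OF R(1)[of x]] R by simp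
  also have "\<dots> \<le> norm x * norm (R x)"
    using complex_Re_le_cmod cmod_cinner_le order_trans by metis
  finally show "norm (R x) \<le> 1 * norm x"
    by (cases "norm (R x) = 0") (auto simp: power2_eq_square)
qed simp

lemma cinner_eigenvectors:
  assumes u: "u \<in> domH" "H u = complex_of_real r *\<^sub>C u" and v: "v \<in> domH" "H v = complex_of_real s *\<^sub>C v"
    and "r \<noteq> s"
  shows "cinner u v = 0"
proof -
  have D: "u \<in> D" "v \<in> D" using assoc_opD(1)[OF dense] u v by auto
  have "complex_of_real r * cinner u v = h u v"
    using assoc_opD(2)[OF dense u(1) D(2)] u(2) by (simp add: cinner_scaleC_left)
  also have "\<dots> = cnj (h v u)" by (rule symmetric[OF D(2,1)])
  also have "\<dots> = complex_of_real s * cinner u v"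
    using assoc_opD(2)[OF dense v(1) D(1)] v(2) cinner_commute[of u v] by (simp add: cinner_scaleC_left)
  finally show ?thesis using \<open>r \<noteq> s\<close> by simp
qed

text \<open>With r = 1/k - w one has k (r - H) R = R - k, so a resolvent bound for \<open>H\<close>
  at r bounds R - k from below.\<close>

lemma R_shift_bounded_below:
  assumes k: "k > 0" and z: "complex_of_real (1 / k - w) \<notin> op_spectrum domH H"
  shows "\<exists>e>0. \<forall>u. e * norm u \<le> norm (R u - complex_of_real k *\<^sub>C u)"
proof -
  define r where "r = 1 / k - w"
  obtain C0 where C0: "\<And>v. v \<in> domH \<Longrightarrow> norm v \<le> C0 * norm (complex_of_real r *\<^sub>C v - H v)"
    using z by (auto simp: op_spectrum_def resolvent_set_def r_def)
  \<comment> \<open>\<open>resolvent_set\<close> leaves the sign of its constant open.\<close>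
  define C where "C = max C0 0"
  have C: "0 \<le> C" "norm v \<le> C * norm (complex_of_real r *\<^sub>C v - H v)" if "v \<in> domH" for v
    using order_trans[OF C0[OF that] mult_right_mono[of C0 C]] by (auto simp: C_def)
  have C0': "0 \<le> C" by (simp add: C_def)
  show ?thesis
  proof (intro exI conjI allI)
    show "k / (C / k + 1) > 0" using k C0' by (auto intro!: divide_pos_pos add_nonneg_pos)
    fix u
    let ?y = "R u - complex_of_real k *\<^sub>C u"
    have "complex_of_real k *\<^sub>C (complex_of_real r *\<^sub>C R u - H (R u)) = ?y"
    proof -
      have "complex_of_real r *\<^sub>C R u - H (R u) = complex_of_real (1 / k) *\<^sub>C R u - u"
        by (simp add: H_R r_def complex_vector.scale_left_diff_distrib)
      then show ?thesis using k by (simp add: complex_vector.scale_right_diff_distrib)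
    qed
    then have "norm ?y = k * norm (complex_of_real r *\<^sub>C R u - H (R u))"
      using k norm_scaleC by (metis abs_of_pos norm_of_real)
    then have Ru: "norm (R u) \<le> C / k * norm ?y"
      using C(2)[OF H_R(1), of u] k by (simp add: field_simps)
    have "k * norm u = norm (R u - ?y)" using k by (simp add: norm_scaleC)
    also have "\<dots> \<le> norm (R u) + norm ?y" by (rule norm_triangle_ineq4)
    also have "\<dots> \<le> (C / k + 1) * norm ?y" using Ru by (simp add: algebra_simps)
    finally have "k * norm u / (C / k + 1) \<le> norm ?y"
      using C0' k by (subst pos_divide_le_eq) (auto simp: mult.commute intro: add_nonneg_pos)
    then show "k / (C / k + 1) * norm u \<le> norm ?y" by simp
  qed
qed

section \<open>Lower bounds for the form relative to a maximal family of eigenvectors\<close>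

context
  fixes \<delta> :: real and E :: "'a set" and \<nu> :: "'a \<Rightarrow> real"
  assumes \<delta>: "0 < \<delta>" "\<delta> < 1" and E: "finite E" "orthonormal E"
    and eigenvectors: "\<And>e. e \<in> E \<Longrightarrow> e \<in> domH" "\<And>e. e \<in> E \<Longrightarrow> H e = complex_of_real (\<nu> e) *\<^sub>C e"
    and spectrum: "\<And>r. r < - \<delta> \<Longrightarrow> complex_of_real r \<in> op_spectrum domH H \<Longrightarrow>
        is_eigenvalue domH H (complex_of_real r)"
    and maximal: "\<And>r u. r < - \<delta> \<Longrightarrow> u \<in> domH \<Longrightarrow> H u = complex_of_real r *\<^sub>C u \<Longrightarrow>
        (\<forall>e\<in>E. cinner u e = 0) \<Longrightarrow> u = 0"
begin

text \<open>The orthogonal complement X of E is invariant under \<open>R\<close>, and maximality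
  leaves no eigenvalue of \<open>R\<close> above 1 / (w - \<delta>) there. The bound on the
  numerical range of \<open>R\<close> on X is then inverted into a bound on h.\<close>

lemma lower_bound_orthogonal:
  assumes u: "u \<in> D" "\<forall>e\<in>E. cinner u e = 0"
  shows "- \<delta> * (norm u)\<^sup>2 \<le> Re (h u u)"
proof (cases "u = 0")
  case False
  define X where "X = {u. \<forall>e\<in>E. cinner u e = 0}"
  \<comment> \<open>The image of -\<delta> under r |-> 1 / (r + w), which is decreasing for r > -w:
    points above \<kappa> for \<open>R\<close> are points below -\<delta> for
    \<open>H\<close>.\<close>
  define \<kappa> where "\<kappa> = 1 / (w - \<delta>)"
  have wd: "w - \<delta> > 0" using w_ge_1 \<delta> by simp
  then have \<kappa>: "\<kappa> > 0" by (simp add: \<kappa>_def)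
  have kr: "1 / k - w < - \<delta>" if "\<kappa> < k" for k
  proof -
    have "1 / k < 1 / \<kappa>" using that \<kappa> by (simp add: frac_less2)
    then show ?thesis by (simp add: \<kappa>_def)
  qed
  have "Re (cinner (R u) u) \<le> \<kappa> * (norm u)\<^sup>2"
  proof (rule R.upper_bound_on_invariant_subspace)
    show "csubspace X"
      by (simp add: X_def csubspace_def cinner_add_left cinner_scaleC_left)
    show "closed X"
      unfolding closed_sequential_limits
    proof (intro allI impI, elim conjE)
      fix f l assume f: "\<forall>n. f n \<in> X" "f \<longlonglongrightarrow> l"
      have "cinner l e = 0" if "e \<in> E" for e
        using tendsto_cinner_left[OF f(2), of e] f(1) that by (simp add: X_def LIMSEQ_const_iff)
      then show "l \<in> X" by (simp add: X_def)
    qed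
    show "R ` X \<subseteq> X"
    proof
      fix y assume "y \<in> R ` X"
      then obtain x where x: "x \<in> X" "y = R x" by blast
      have "cinner y e = 0" if e: "e \<in> E" for e
      proof -
        have "cinner y (complex_of_real (\<nu> e + w) *\<^sub>C e) = cinner x (complex_of_real (\<nu> e + w) *\<^sub>C R e)"
          unfolding x(2) R.adjoint R.scale ..
        also have "\<dots> = cinner x e"
          using R_eigenvector[OF eigenvectors[OF e]] by simp
        also have "\<dots> = 0" using x e by (simp add: X_def)
        finally have "complex_of_real (\<nu> e + w) * cinner y e = 0"
          by (simp add: cinner_scaleC_right)
        moreover have "1 \<le> \<nu> e + w"
          using eigenvalue_gt[OF eigenvectors[OF e]] orthonormal_norm[OF E(2) e] by fastforce
        ultimately show ?thesis
          by (metis mult_eq_0_iff not_one_le_zero of_real_eq_0_iff)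
      qed
      then show "y \<in> X" by (simp add: X_def)
    qed
    \<comment> \<open>The exceptional points: at 1 / (\<nu> e + w) the resolvent bound for
      \<open>H\<close> fails because of e itself, although e is orthogonal to X. At any other point
      an eigenvector would be orthogonal to all of E, against maximality.\<close>
    show "finite ((\<lambda>e. 1 / (\<nu> e + w)) ` E)" using E by simp
    show "u \<in> X" using u by (simp add: X_def)
    show "v = 0" if k: "\<kappa> < k" and v: "v \<in> X" "R v = complex_of_real k *\<^sub>C v" for k v
    proof -
      have k0: "k > 0" using k \<kappa> by simp
      have "complex_of_real (1 / k) *\<^sub>C R v = v"
        using k0 by (simp add: v(2))
      then have "H (R v) = complex_of_real (1 / k - w) *\<^sub>C R v"
        by (simp add: H_R(2) complex_vector.scale_left_diff_distrib)
      moreover have "\<forall>e\<in>E. cinner (R v) e = 0"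
        using v by (simp add: X_def cinner_scaleC_left)
      ultimately have "R v = 0" using maximal[OF kr[OF k] H_R(1)] by blast
      then show ?thesis using v(2) k0 by simp
    qed
    show "\<exists>e>0. \<forall>v\<in>X. e * norm v \<le> norm (R v - complex_of_real k *\<^sub>C v)"
      if k: "\<kappa> < k" "k \<notin> (\<lambda>e. 1 / (\<nu> e + w)) ` E" for k
    proof -
      have k0: "k > 0" using k \<kappa> by simp
      have "complex_of_real (1 / k - w) \<notin> op_spectrum domH H"
      proof
        assume "complex_of_real (1 / k - w) \<in> op_spectrum domH H"
        then obtain v where v: "v \<in> domH" "v \<noteq> 0" "H v = complex_of_real (1 / k - w) *\<^sub>C v"
          using spectrum[OF kr[OF k(1)]] by (auto simp: is_eigenvalue_def)
        have "\<forall>e\<in>E. cinner v e = 0"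
        proof
          fix e assume e: "e \<in> E"
          have "k \<noteq> 1 / (\<nu> e + w)" using k(2) e by blast
          moreover have "k = 1 / (\<nu> e + w)" if "1 / k - w = \<nu> e"
            by (simp flip: that)
          ultimately have "1 / k - w \<noteq> \<nu> e" by blast
          then show "cinner v e = 0"
            using cinner_eigenvectors[OF v(1,3) eigenvectors[OF e]] by simp
        qed
        then show False using maximal[OF kr[OF k(1)] v(1,3)] v(2) by blast
      qed
      then show ?thesis using R_shift_bounded_below[OF k0] by blast
    qed
  qed
  moreover have "cinner u (R u) = cinner (R u) u" by (rule R.adjoint[symmetric])
  \<comment> \<open>The upper bound R <= \<kappa> becomes H + w >= 1/\<kappa> through Cauchy-Schwarz
    for \<open>q\<close> between R u and u, because q(R u, u) = |u|^2.\<close>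
  moreover have "((norm u)\<^sup>2)\<^sup>2 \<le> Re (cinner u (R u)) * Re (q u u)"
    using q.cauchy_schwarz[OF R(1) u(1), of u]
    by (simp add: R u(1) cinner_self norm_power del: of_real_power)
  moreover have q0: "0 \<le> Re (q u u)" by (rule q.nonneg[OF u(1)])
  ultimately have "((norm u)\<^sup>2)\<^sup>2 \<le> \<kappa> * (norm u)\<^sup>2 * Re (q u u)"
    by (metis mult_right_mono order_trans)
  then have "(norm u)\<^sup>2 * (norm u)\<^sup>2 \<le> (\<kappa> * Re (q u u)) * (norm u)\<^sup>2"
    by (simp add: power2_eq_square mult_ac)
  then have "(norm u)\<^sup>2 \<le> \<kappa> * Re (q u u)"
    using False by (subst (asm) mult_le_cancel_right) auto
  then have "(w - \<delta>) * (norm u)\<^sup>2 \<le> Re (q u u)"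
    using wd by (simp add: \<kappa>_def field_simps)
  then show ?thesis by (simp add: Re_q algebra_simps)
qed (simp add: sesquilinear_form_0[OF sesquilinear csubspaceD(1)[OF q.subspace]])

text \<open>Split x into its projection p onto the span of E and a part y orthogonal to E. Mixed
  terms vanish because E consists of eigenvectors, h(p,p) is the sum, and y falls under the
  orthogonal case with |y| <= |x|.\<close>

lemma lower_bound:
  assumes x: "x \<in> D"
  shows "(\<Sum>e\<in>E. \<nu> e * (cmod (cinner x e))\<^sup>2) - \<delta> * (norm x)\<^sup>2 \<le> Re (h x x)"
proof -
  define p y where "p = (\<Sum>e\<in>E. cinner x e *\<^sub>C e)" and "y = x - p"
  have ED: "e \<in> D" if "e \<in> E" for e using assoc_opD(1)[OF dense eigenvectors(1)[OF that]] .
  have pD: "p \<in> D" unfolding p_def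
    using q.subspace ED unfolding csubspace_iff
    by (intro complex_vector.subspace_sum complex_vector.subspace_scale)
  have yD: "y \<in> D" using x pD q.closed_under by (simp add: y_def)
  have xpy: "x = p + y" by (simp add: y_def)
  have pe: "cinner p e = cinner x e" if "e \<in> E" for e
    unfolding p_def by (rule cinner_orthonormal_sum[OF E that])
  have ye: "cinner y e = 0" if "e \<in> E" for e by (simp add: y_def cinner_diff_left pe[OF that])
  have hp: "h p v = (\<Sum>e\<in>E. cinner x e * complex_of_real (\<nu> e) * cnj (cinner v e))" if v: "v \<in> D" for v
  proof -
    have "h p v = (\<Sum>e\<in>E. h (cinner x e *\<^sub>C e) v)"
      unfolding p_def by (rule sesquilinear_form_sum_left[OF sesquilinear _ v]) (use ED q.closed_under in auto)
    also have "\<dots> = (\<Sum>e\<in>E. cinner x e * complex_of_real (\<nu> e) * cnj (cinner v e))"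
    proof (rule sum.cong[OF refl])
      fix e assume e: "e \<in> E"
      show "h (cinner x e *\<^sub>C e) v = cinner x e * complex_of_real (\<nu> e) * cnj (cinner v e)"
        using cinner_commute[of e v]
        by (simp add: sesquilinear_formD(3)[OF sesquilinear ED[OF e] v] cinner_scaleC_left
            assoc_opD(2)[OF dense eigenvectors(1)[OF e] v] eigenvectors(2)[OF e])
    qed
    finally show ?thesis .
  qed
  have hpy: "h p y = 0" unfolding hp[OF yD] by (simp add: ye)
  then have hyp: "h y p = 0" using symmetric[OF pD yD] by simp
  have "h p p = complex_of_real (\<Sum>e\<in>E. \<nu> e * (cmod (cinner x e))\<^sup>2)"
    unfolding hp[OF pD] by (simp add: pe complex_norm_square mult_ac del: of_real_power)
  then have hpp: "Re (h p p) = (\<Sum>e\<in>E. \<nu> e * (cmod (cinner x e))\<^sup>2)"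
    by (metis Re_complex_of_real)
  have "h x x = h p p + h p y + (h y p + h y y)"
    unfolding xpy using pD yD q.closed_under by (simp add: sesquilinear_formD[OF sesquilinear])
  then have "Re (h x x) = (\<Sum>e\<in>E. \<nu> e * (cmod (cinner x e))\<^sup>2) + Re (h y y)"
    by (simp add: hpy hyp hpp)
  moreover have "- \<delta> * (norm y)\<^sup>2 \<le> Re (h y y)"
    using lower_bound_orthogonal[OF yD] ye by blast
  moreover have "norm y \<le> norm x"
  proof -
    have "cinner p y = 0"
      unfolding p_def cinner_sum_left
    proof (intro sum.neutral ballI)
      fix e assume "e \<in> E"
      then show "cinner (cinner x e *\<^sub>C e) y = 0"
        using cinner_commute[of e y] ye by (simp add: cinner_scaleC_left)
    qed
    then have "cinner x y = complex_of_real ((norm y)\<^sup>2)"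
      unfolding xpy by (simp add: cinner_add_left cinner_self)
    then have "(norm y)\<^sup>2 \<le> norm x * norm y"
      using cmod_cinner_le[of x y] complex_Re_le_cmod[of "cinner x y"] by (metis Re_complex_of_real order_trans)
    then show ?thesis by (cases "norm y = 0") (auto simp: power2_eq_square)
  qed
  then have "\<delta> * (norm y)\<^sup>2 \<le> \<delta> * (norm x)\<^sup>2"
    using \<delta>(1) by (intro mult_left_mono power_mono) auto
  ultimately show ?thesis by simp
qed

end

end

section \<open>Schur bases of generalized eigenspaces\<close>

lemma cindependent_iff: "finite B \<Longrightarrow> cindependent B \<longleftrightarrow> complex_vector.independent B"
  by (auto simp: cindependent_def complex_vector.dependent_finite)

lemma orthonormal_cindependent:
  assumes "finite E" "orthonormal E" shows "cindependent E"
  unfolding cindependent_def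
proof (intro allI impI ballI)
  fix c e assume "(\<Sum>b\<in>E. c b *\<^sub>C b) = 0" "e \<in> E"
  then show "c e = 0" using cinner_orthonormal_sum[OF assms, of e c] by simp
qed

lemma orthogonal_span:
  assumes "\<forall>x\<in>S. cinner e x = 0" "y \<in> complex_vector.span S"
  shows "cinner e y = 0"
proof -
  have "complex_vector.subspace {y. cinner e y = 0}"
    by (simp add: complex_vector.subspace_def cinner_add_right cinner_scaleC_right)
  then have "complex_vector.span S \<subseteq> {y. cinner e y = 0}"
    using assms(1) by (intro complex_vector.span_minimal) auto
  then show ?thesis using assms(2) by blast
qed

text \<open>A Schur basis in reverse order: the head is the vector added last, and on the span T is
  upper triangular with diagonal \<open>zs\<close>.\<close>

fun schur_list :: "'a::complex_inner set \<Rightarrow> ('a \<Rightarrow> 'a) \<Rightarrow> 'a list \<Rightarrow> complex list \<Rightarrow> bool" where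
  "schur_list DT T [] [] = True"
| "schur_list DT T (e # es) (z # zs) = (schur_list DT T es zs \<and> e \<in> DT \<and> norm e = 1 \<and>
     (\<forall>x\<in>set es. cinner e x = 0) \<and> T e - z *\<^sub>C e \<in> complex_vector.span (set es))"
| "schur_list DT T _ _ = False"

lemma schur_list_orthonormal:
  "schur_list DT T es zs \<Longrightarrow> orthonormal (set es) \<and> distinct es \<and> set es \<subseteq> DT"
proof (induction DT T es zs rule: schur_list.induct)
  case (2 DT T e es z zs)
  then have IH: "orthonormal (set es)" "distinct es" "set es \<subseteq> DT" by auto
  have e: "cinner e e = 1" "\<And>x. x \<in> set es \<Longrightarrow> cinner e x = 0" "\<And>x. x \<in> set es \<Longrightarrow> cinner x e = 0"
    using "2.prems" cinner_commute[of _ e] by (auto simp: cinner_self)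
  then have "e \<notin> set es" by force
  then show ?case using IH e "2.prems" by (auto simp: orthonormal_def)
qed (auto simp: orthonormal_def)

text \<open>T e - z e lies in the span of the tail, hence is orthogonal to e, and so z = <T e, e>.
  For an associated operator this is a value of the form.\<close>

lemma schur_list_diagonal:
  "schur_list DT T es zs \<Longrightarrow> zs = map (\<lambda>e. cinner (T e) e) es"
proof (induction DT T es zs rule: schur_list.induct)
  case (2 DT T e es z zs)
  have "cinner e (T e - z *\<^sub>C e) = 0"
    using "2.prems" by (intro orthogonal_span[of "set es"]) auto
  then have "cinner (T e - z *\<^sub>C e) e = 0" using cinner_commute[of "T e - z *\<^sub>C e" e] by simp
  then show ?case using 2 by (simp add: cinner_diff_left cinner_scaleC_left cinner_self)
qed auto

locale partial_linear_operator =
  fixes DT :: "'a::complex_inner set" and T :: "'a \<Rightarrow> 'a"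
  assumes dom: "csubspace DT"
    and add: "u \<in> DT \<Longrightarrow> v \<in> DT \<Longrightarrow> T (u + v) = T u + T v"
    and scale: "u \<in> DT \<Longrightarrow> T (c *\<^sub>C u) = c *\<^sub>C T u"
begin

lemma diff: "u \<in> DT \<Longrightarrow> v \<in> DT \<Longrightarrow> T (u - v) = T u - T v"
  using add[of "u - v" v] csubspaceD(4)[OF dom] by simp

lemma gen_kernel_subspace: "csubspace (gen_kernel DT T z k)"
proof (induction k)
  case (Suc k)
  have "T 0 = 0" using scale[OF csubspaceD(1)[OF dom], of 0] by simp
  then show ?case
    unfolding csubspace_def
  proof (intro conjI ballI allI)
    fix x y assume xy: "x \<in> gen_kernel DT T z (Suc k)" "y \<in> gen_kernel DT T z (Suc k)"
    have "z *\<^sub>C (x + y) - T (x + y) = (z *\<^sub>C x - T x) + (z *\<^sub>C y - T y)"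
      using xy by (simp add: add complex_vector.scale_right_distrib)
    then show "x + y \<in> gen_kernel DT T z (Suc k)"
      using xy csubspaceD(2)[OF Suc] csubspaceD(2)[OF dom] by simp
  next
    fix x c assume x: "x \<in> gen_kernel DT T z (Suc k)"
    have "z *\<^sub>C (c *\<^sub>C x) - T (c *\<^sub>C x) = c *\<^sub>C (z *\<^sub>C x - T x)"
      using x by (simp add: scale complex_vector.scale_right_diff_distrib mult.commute)
    then show "c *\<^sub>C x \<in> gen_kernel DT T z (Suc k)"
      using x csubspaceD(3)[OF Suc] csubspaceD(3)[OF dom] by simp
  qed (use csubspaceD(1)[OF Suc] csubspaceD(1)[OF dom] in simp)
qed (simp add: csubspace_def)

lemma schur_list_invariant:
  "schur_list DT T es zs \<Longrightarrow> u \<in> complex_vector.span (set es) \<Longrightarrow>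
    u \<in> DT \<and> T u \<in> complex_vector.span (set es)"
proof (induction es zs arbitrary: u rule: list_induct2')
  case 1
  have "T 0 = 0" using scale[OF csubspaceD(1)[OF dom], of 0] by simp
  then show ?case using 1 csubspaceD(1)[OF dom] by simp
next
  case (4 e es z zs)
  let ?V = "complex_vector.span (set es)" and ?W = "complex_vector.span (set (e # es))"
  have VW: "?V \<subseteq> ?W" by (intro complex_vector.span_mono) auto
  obtain c where c: "u - c *\<^sub>C e \<in> ?V"
    using "4.prems"(2) by (auto simp: complex_vector.span_breakdown_eq)
  have e: "e \<in> DT" "T e - z *\<^sub>C e \<in> ?V" using "4.prems" by auto
  have IH: "u - c *\<^sub>C e \<in> DT" "T (u - c *\<^sub>C e) \<in> ?V"
    using "4.IH" "4.prems"(1) c by auto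
  have uD: "u \<in> DT" using csubspaceD(2)[OF dom IH(1) csubspaceD(3)[OF dom e(1), of c]] by simp
  have "T u = T (u - c *\<^sub>C e) + c *\<^sub>C T e"
    using diff[OF uD csubspaceD(3)[OF dom e(1)]] scale[OF e(1)] by simp
  then have "T u = T (u - c *\<^sub>C e) + c *\<^sub>C (T e - z *\<^sub>C e) + (c * z) *\<^sub>C e"
    by (simp add: complex_vector.scale_right_diff_distrib)
  moreover have "e \<in> ?W" by (intro complex_vector.span_base) simp
  ultimately show ?case
    using uD VW IH(2) e(2) by (auto intro!: complex_vector.span_add complex_vector.span_scale)
qed auto

text \<open>Appending a basis vector enlarges the generalized kernel of \<open>z\<close> by at most one dimension, and
  not at all if the new diagonal entry differs from \<open>z\<close>.\<close>
lemma schur_list_gen_kernel: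
  "schur_list DT T es zs \<Longrightarrow> \<exists>S. finite S \<and> card S \<le> count_list zs z \<and>
     gen_kernel DT T z k \<inter> complex_vector.span (set es) \<subseteq> complex_vector.span S"
proof (induction es zs rule: list_induct2')
  case 1
  then show ?case by (intro exI[of _ "{}"]) auto
next
  case (4 e es l zs)
  let ?V = "complex_vector.span (set es)" and ?W = "complex_vector.span (set (e # es))"
  let ?G = "\<lambda>k. gen_kernel DT T z k"
  have V: "csubspace ?V" by (simp add: csubspace_iff)
  have e: "e \<in> DT" "T e - l *\<^sub>C e \<in> ?V" "e \<notin> ?V"
  proof -
    show "e \<notin> ?V" using orthogonal_span[of "set es" e e] "4.prems" by (auto simp: cinner_self)
  qed (use "4.prems" in auto)
  have schur: "schur_list DT T es zs" using "4.prems" by simp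
  obtain S where S: "finite S" "card S \<le> count_list zs z" "?G k \<inter> ?V \<subseteq> complex_vector.span S"
    using "4.IH" schur by auto
  show ?case
  proof (cases "?G k \<inter> ?W \<subseteq> ?V")
    case True
    then show ?thesis using S by (intro exI[of _ S]) auto
  next
    case False
    then obtain u0 where u0: "u0 \<in> ?G k" "u0 \<in> ?W" "u0 \<notin> ?V" by blast
    obtain \<alpha> where \<alpha>: "u0 - \<alpha> *\<^sub>C e \<in> ?V"
      using u0(2) by (auto simp: complex_vector.span_breakdown_eq)
    have \<alpha>0: "\<alpha> \<noteq> 0" using \<alpha> u0(3) by auto
    \<comment> \<open>\<beta> is the e-coordinate of u modulo \<open>?V\<close>. Each application of
      z - T multiplies it by z - l, and after j applications nothing is left.\<close>
    have zero: "\<beta> = 0" if "l \<noteq> z" "u \<in> ?G j" "u - \<beta> *\<^sub>C e \<in> ?V" for \<beta> u j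
      using that(2,3)
    proof (induction j arbitrary: u \<beta>)
      case 0
      then have "- (\<beta> *\<^sub>C e) \<in> ?V" by simp
      then have "\<beta> *\<^sub>C e \<in> ?V" using csubspaceD(5)[OF V] by fastforce
      then have "inverse \<beta> *\<^sub>C \<beta> *\<^sub>C e \<in> ?V" by (rule csubspaceD(3)[OF V])
      then show ?case using e(3) by (cases "\<beta> = 0") auto
    next
      case (Suc j)
      define y where "y = u - \<beta> *\<^sub>C e"
      have u: "u \<in> DT" "z *\<^sub>C u - T u \<in> ?G j" using Suc.prems by auto
      have be: "\<beta> *\<^sub>C e \<in> DT" by (rule csubspaceD(3)[OF dom e(1)])
      have "T y = T u - \<beta> *\<^sub>C T e" using diff[OF u(1) be] scale[OF e(1)] by (simp add: y_def)
      then have "(z *\<^sub>C u - T u) - (\<beta> * (z - l)) *\<^sub>C e = z *\<^sub>C y - T y - \<beta> *\<^sub>C (T e - l *\<^sub>C e)"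
        by (simp add: y_def complex_vector.scale_right_diff_distrib algebra_simps
            complex_vector.scale_left_diff_distrib)
      moreover have "z *\<^sub>C y - T y - \<beta> *\<^sub>C (T e - l *\<^sub>C e) \<in> ?V"
      proof -
        have y: "y \<in> ?V" using Suc.prems(2) by (simp add: y_def)
        then have "T y \<in> ?V" using schur_list_invariant[OF schur] by blast
        from csubspaceD(4)[OF V csubspaceD(4)[OF V csubspaceD(3)[OF V y] this] csubspaceD(3)[OF V e(2)]]
        show ?thesis .
      qed
      ultimately have "\<beta> * (z - l) = 0" by (intro Suc.IH[OF u(2)]) simp
      then show ?case using that(1) by simp
    qed
    have lz: "l = z" using zero[OF _ u0(1) \<alpha>] \<alpha>0 by blast
    show ?thesis
    proof (intro exI[of _ "insert u0 S"] conjI subsetI)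
      show "finite (insert u0 S)" using S by simp
      show "card (insert u0 S) \<le> count_list (l # zs) z"
        using S lz by (simp add: card_insert_if)
      fix u assume u: "u \<in> ?G k \<inter> ?W"
      then obtain \<beta> where \<beta>: "u - \<beta> *\<^sub>C e \<in> ?V" by (auto simp: complex_vector.span_breakdown_eq)
      \<comment> \<open>Subtracting this multiple of \<open>u0\<close> removes the e-coordinate and
        leaves a vector of the generalized kernel inside \<open>?V\<close>.\<close>
      let ?c = "\<beta> / \<alpha>"
      have "u - ?c *\<^sub>C u0 = (u - \<beta> *\<^sub>C e) - ?c *\<^sub>C (u0 - \<alpha> *\<^sub>C e)"
        using \<alpha>0 by (simp add: complex_vector.scale_right_diff_distrib)
      also have "\<dots> \<in> ?V" by (intro csubspaceD(4)[OF V] csubspaceD(3)[OF V] \<alpha> \<beta>)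
      finally have "u - ?c *\<^sub>C u0 \<in> ?V" .
      moreover have "u - ?c *\<^sub>C u0 \<in> ?G k"
        using u u0(1) csubspaceD[OF gen_kernel_subspace[of z k]] by blast
      ultimately show "u \<in> complex_vector.span (insert u0 S)"
        using S(3) unfolding complex_vector.span_breakdown_eq by blast
    qed
  qed
qed auto

text \<open>By dimension, some generalized kernel leaves the span V of \<open>es\<close>. At the
  least such exponent there is u outside V with (z - T) u in V. Gram-Schmidt changes u only by an
  element of the invariant space V, so this property survives.\<close>

lemma schur_list_extend:
  assumes schur: "schur_list DT T es zs" and less: "enat (count_list zs z) < alg_mult DT T z"
  shows "\<exists>e. schur_list DT T (e # es) (z # zs)"
proof -
  let ?V = "complex_vector.span (set es)"
  have V: "csubspace ?V" by (simp add: csubspace_iff)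
  obtain k B where B: "finite B" "B \<subseteq> gen_kernel DT T z k" "cindependent B" "count_list zs z < card B"
    using less unfolding alg_mult_def cdim_def by (auto simp: less_SUP_iff)
  have "\<not> gen_kernel DT T z k \<subseteq> ?V"
  proof
    assume "gen_kernel DT T z k \<subseteq> ?V"
    then obtain S where S: "finite S" "card S \<le> count_list zs z" "B \<subseteq> complex_vector.span S"
      using schur_list_gen_kernel[OF schur, of z k] B(2) by blast
    then have "card B \<le> card S"
      using complex_vector.independent_span_bound[of S B] B cindependent_iff by blast
    then show False using S B by simp
  qed
  then obtain j where j: "\<not> gen_kernel DT T z j \<subseteq> ?V" "\<And>i. i < j \<Longrightarrow> gen_kernel DT T z i \<subseteq> ?V"
    using exists_least_iff[of "\<lambda>k. \<not> gen_kernel DT T z k \<subseteq> ?V"] by auto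
  \<comment> \<open>j > 0, since the kernel of exponent 0 is trivial.\<close>
  obtain i where i: "j = Suc i"
    using j(1) csubspaceD(1)[OF V] by (cases j) auto
  then obtain u where u: "u \<in> DT" "z *\<^sub>C u - T u \<in> ?V" "u \<notin> ?V"
    using j by auto
  define p y where "p = (\<Sum>x\<in>set es. cinner u x *\<^sub>C x)" and "y = u - p"
  define e where "e = complex_of_real (1 / norm y) *\<^sub>C y"
  have p: "p \<in> ?V" unfolding p_def
    by (intro complex_vector.span_sum complex_vector.span_scale complex_vector.span_base)
  note Tp = schur_list_invariant[OF schur p]
  have yD: "y \<in> DT" using u(1) Tp csubspaceD(4)[OF dom] by (simp add: y_def)
  have y0: "y \<noteq> 0" using u(3) p by (auto simp: y_def)
  have "T y - z *\<^sub>C y = (z *\<^sub>C p - T p) - (z *\<^sub>C u - T u)"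
    using diff[OF u(1)] Tp by (simp add: y_def complex_vector.scale_right_diff_distrib)
  also have "\<dots> \<in> ?V"
    by (rule csubspaceD(4)[OF V csubspaceD(4)[OF V csubspaceD(3)[OF V p] conjunct2[OF Tp]] u(2)])
  finally have Ty: "T y - z *\<^sub>C y \<in> ?V" .
  have "T e - z *\<^sub>C e = complex_of_real (1 / norm y) *\<^sub>C (T y - z *\<^sub>C y)"
    by (simp add: e_def scale[OF yD] complex_vector.scale_right_diff_distrib mult.commute)
  then have "T e - z *\<^sub>C e \<in> ?V" using csubspaceD(3)[OF V Ty] by simp
  moreover have "cinner e x = 0" if "x \<in> set es" for x
    using cinner_orthonormal_sum[of "set es" x "cinner u"] schur_list_orthonormal[OF schur] that
    by (simp add: e_def cinner_scaleC_left y_def p_def cinner_diff_left)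
  moreover have "norm e = 1" using y0 by (simp add: e_def norm_scaleC norm_divide)
  moreover have "e \<in> DT" unfolding e_def by (rule csubspaceD(3)[OF dom yD])
  ultimately have "schur_list DT T (e # es) (z # zs)" using schur by simp
  then show ?thesis ..
qed

theorem schur_list_exists:
  "(\<And>z. enat (count_list zs z) \<le> alg_mult DT T z) \<Longrightarrow> \<exists>es. schur_list DT T es zs"
proof (induction zs)
  case Nil
  then show ?case by (intro exI[of _ "[]"]) simp
next
  case (Cons z zs)
  have le: "enat (count_list zs x) \<le> alg_mult DT T x" for x
    using order_trans[OF _ Cons.prems[of x]] by (metis count_list.simps(2) enat_ord_simps(1) le_add1 order_refl)
  then obtain es where es: "schur_list DT T es zs" using Cons.IH by blast
  have "enat (count_list zs z) < enat (count_list (z # zs) z)" by simp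
  also have "\<dots> \<le> alg_mult DT T z" by (rule Cons.prems)
  finally show ?case using schur_list_extend[OF es] by blast
qed

end

lemma partial_linear_operator_assoc_op:
  assumes a: "sesquilinear_form D a" and D: "densely_defined D"
  shows "partial_linear_operator (assoc_dom D a) (assoc_op D a)"
proof -
  let ?A = "assoc_op D a"
  note subspace = csubspaceD[OF sesquilinear_formD(1)[OF a]]
  have add: "u + v \<in> assoc_dom D a \<and> ?A (u + v) = ?A u + ?A v"
    if "u \<in> assoc_dom D a" "v \<in> assoc_dom D a" for u v
  proof -
    have "a (u + v) x = cinner (?A u + ?A v) x" if "x \<in> D" for x
      using assoc_opD[OF D \<open>u \<in> _\<close>] assoc_opD[OF D \<open>v \<in> _\<close>] that
      by (simp add: sesquilinear_formD[OF a] cinner_add_left)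
    from assoc_opI[where a = a, OF D subspace(2)[OF assoc_opD(1)[OF D that(1)] assoc_opD(1)[OF D that(2)]] this]
    show ?thesis by blast
  qed
  have scale: "c *\<^sub>C u \<in> assoc_dom D a \<and> ?A (c *\<^sub>C u) = c *\<^sub>C ?A u"
    if "u \<in> assoc_dom D a" for c u
  proof -
    have "a (c *\<^sub>C u) x = cinner (c *\<^sub>C ?A u) x" if "x \<in> D" for x
      using assoc_opD[OF D \<open>u \<in> _\<close>] that
      by (simp add: sesquilinear_formD[OF a] cinner_scaleC_left)
    from assoc_opI[where a = a, OF D subspace(3)[OF assoc_opD(1)[OF D that]] this]
    show ?thesis by blast
  qed
  have "0 \<in> assoc_dom D a"
    by (rule assoc_opI[OF D, of _ _ 0]) (simp_all add: subspace sesquilinear_form_0[OF a])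
  then show ?thesis
    using add scale by unfold_locales (auto simp: csubspace_def)
qed

text \<open>Group E by eigenvalue: each group is an independent set in a kernel of exponent 1, so
  its size is at most the algebraic multiplicity.\<close>

lemma neg_trace_ge:
  assumes E: "finite E" "orthonormal E"
    and eigen: "\<And>e. e \<in> E \<Longrightarrow> e \<in> DT" "\<And>e. e \<in> E \<Longrightarrow> T e = complex_of_real (\<nu> e) *\<^sub>C e"
      "\<And>e. e \<in> E \<Longrightarrow> \<nu> e < 0"
  shows "ennreal (\<Sum>e\<in>E. (- \<nu> e) powr \<gamma>) \<le> neg_trace DT T \<gamma>"
proof -
  have mult: "enat (card {e \<in> E. \<nu> e = \<mu>}) \<le> alg_mult DT T (complex_of_real \<mu>)" for \<mu>
  proof -
    let ?B = "{e \<in> E. \<nu> e = \<mu>}"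
    have "orthonormal ?B" using E(2) by (auto simp: orthonormal_def)
    then have "cindependent ?B" using E(1) by (intro orthonormal_cindependent) auto
    moreover have "?B \<subseteq> gen_kernel DT T (complex_of_real \<mu>) 1"
      using eigen by (auto simp: numeral_eq_Suc)
    ultimately have "enat (card ?B) \<le> cdim (gen_kernel DT T (complex_of_real \<mu>) 1)"
      unfolding cdim_def using E(1) by (intro SUP_upper) auto
    also have "\<dots> \<le> alg_mult DT T (complex_of_real \<mu>)"
      unfolding alg_mult_def by (rule SUP_upper) simp
    finally show ?thesis .
  qed
  have "ennreal (\<Sum>e\<in>E. (- \<nu> e) powr \<gamma>) = (\<Sum>e\<in>E. ennreal ((- \<nu> e) powr \<gamma>))"
    by (intro sum_ennreal[symmetric]) simp
  also have "\<dots> = (\<Sum>\<mu>\<in>\<nu> ` E. \<Sum>e\<in>{e \<in> E. \<nu> e = \<mu>}. ennreal ((- \<nu> e) powr \<gamma>))"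
    by (rule sum.image_gen[OF E(1)])
  also have "\<dots> = (\<Sum>\<mu>\<in>\<nu> ` E. of_nat (card {e \<in> E. \<nu> e = \<mu>}) * ennreal ((- \<mu>) powr \<gamma>))"
    by (intro sum.cong refl) simp
  also have "\<dots> \<le> (\<Sum>\<mu>\<in>\<nu> ` E. ennreal_of_enat (alg_mult DT T (complex_of_real \<mu>)) * ennreal ((- \<mu>) powr \<gamma>))"
    using mult by (intro sum_mono mult_right_mono)
      (auto simp: ennreal_of_enat_le_iff simp flip: ennreal_of_enat_enat)
  also have "\<dots> \<le> neg_trace DT T \<gamma>"
    unfolding neg_trace_def
  proof (rule SUP_upper, intro CollectI conjI ballI)
    fix \<mu> assume "\<mu> \<in> \<nu> ` E"
    then obtain e where e: "e \<in> E" "\<mu> = \<nu> e" by blast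
    then have "e \<noteq> 0" using orthonormal_norm[OF E(2)] by force
    then show "is_eigenvalue DT T (complex_of_real \<mu>)" "\<mu> < 0"
      using e eigen by (auto simp: is_eigenvalue_def)
  qed (use E in simp)
  finally show ?thesis .
qed

section \<open>The trace inequality\<close>

text \<open>Jensen's inequality for the convex power, read off its tangent at t. Weights of total at
  most 1 suffice because the constant term t^\<gamma> (1 - \<gamma>) of the tangent is
  nonpositive.\<close>

lemma powr_sum_ge:
  fixes c y :: "'b \<Rightarrow> real"
  assumes E: "finite E" "\<And>e. e \<in> E \<Longrightarrow> 0 \<le> c e" "\<And>e. e \<in> E \<Longrightarrow> 0 < y e" "(\<Sum>e\<in>E. c e) \<le> 1"
    and t: "0 < t" "t \<le> (\<Sum>e\<in>E. c e * y e)" and \<gamma>: "1 \<le> \<gamma>"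
  shows "t powr \<gamma> \<le> (\<Sum>e\<in>E. c e * y e powr \<gamma>)"
proof -
  have bernoulli: "1 + \<gamma> * (s - 1) \<le> s powr \<gamma>" if s: "0 < s" for s :: real
  proof -
    \<comment> \<open>Young's inequality for s^\<gamma> and 1 with weights 1/\<gamma> and 1 -
      1/\<gamma> rearranges to Bernoulli's inequality, the tangent of the power at 1.\<close>
    have "(s powr \<gamma>) powr (1 / \<gamma>) * 1 powr (1 - 1 / \<gamma>) \<le> 1 / \<gamma> * s powr \<gamma> + (1 - 1 / \<gamma>) * 1"
      using s \<gamma> by (intro Youngs_inequality_0) auto
    then have "s \<le> 1 / \<gamma> * s powr \<gamma> + (1 - 1 / \<gamma>)"
      using s \<gamma> by (simp add: powr_powr)
    then have "\<gamma> * s \<le> \<gamma> * (1 / \<gamma> * s powr \<gamma> + (1 - 1 / \<gamma>))"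
      using \<gamma> by (intro mult_left_mono) auto
    then show ?thesis using \<gamma> by (simp add: algebra_simps)
  qed
  have tangent: "t powr \<gamma> * (1 - \<gamma>) + \<gamma> * t powr \<gamma> / t * y e \<le> y e powr \<gamma>" if e: "e \<in> E" for e
  proof -
    have "t powr \<gamma> * (1 + \<gamma> * (y e / t - 1)) \<le> t powr \<gamma> * (y e / t) powr \<gamma>"
      using bernoulli[of "y e / t"] E(3)[OF e] t by (intro mult_left_mono) auto
    also have "\<dots> = y e powr \<gamma>"
      using E(3)[OF e] t by (simp add: powr_divide)
    finally show ?thesis by (simp add: algebra_simps)
  qed
  have "t powr \<gamma> = t powr \<gamma> * (1 - \<gamma>) * 1 + \<gamma> * t powr \<gamma> / t * t"
    using t by (simp add: algebra_simps)
  also have "\<dots> \<le> t powr \<gamma> * (1 - \<gamma>) * (\<Sum>e\<in>E. c e) + \<gamma> * t powr \<gamma> / t * (\<Sum>e\<in>E. c e * y e)"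
    using E(4) t \<gamma> by (intro add_mono mult_left_mono mult_left_mono_neg) (auto simp: mult_le_0_iff)
  also have "\<dots> = (\<Sum>e\<in>E. c e * (t powr \<gamma> * (1 - \<gamma>) + \<gamma> * t powr \<gamma> / t * y e))"
    by (simp add: sum_distrib_left sum_distrib_right distrib_left sum.distrib mult_ac)
  also have "\<dots> \<le> (\<Sum>e\<in>E. c e * y e powr \<gamma>)"
    using E tangent by (intro sum_mono mult_left_mono) auto
  finally show ?thesis .
qed

context closed_symmetric_form
begin

text \<open>Every vector of such a family contributes at least \<delta>^\<gamma>, so the finite
  trace bounds the size of all families. One of largest size is maximal: a further orthogonal
  eigenvector could be normalised and added.\<close>

lemma maximal_eigenvectors:
  assumes finite_trace: "neg_trace domH H \<gamma> < \<infinity>" and \<delta>: "0 < \<delta>" and \<gamma>: "0 \<le> \<gamma>"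
  obtains E \<nu> where "finite E" "orthonormal E" "\<And>e. e \<in> E \<Longrightarrow> e \<in> domH"
    "\<And>e. e \<in> E \<Longrightarrow> H e = complex_of_real (\<nu> e) *\<^sub>C e" "\<And>e. e \<in> E \<Longrightarrow> \<nu> e < - \<delta>"
    "\<And>r u. r < - \<delta> \<Longrightarrow> u \<in> domH \<Longrightarrow> H u = complex_of_real r *\<^sub>C u \<Longrightarrow>
        (\<forall>e\<in>E. cinner u e = 0) \<Longrightarrow> u = 0"
proof -
  define P where "P E \<longleftrightarrow> finite E \<and> orthonormal E \<and>
      (\<forall>e\<in>E. e \<in> domH \<and> (\<exists>r. r < - \<delta> \<and> H e = complex_of_real r *\<^sub>C e))" for E
  obtain b where b: "neg_trace domH H \<gamma> = ennreal b" "0 \<le> b"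
    using finite_trace by (cases "neg_trace domH H \<gamma>") auto
  have choose: "\<exists>\<nu>. \<forall>e\<in>E. e \<in> domH \<and> \<nu> e < - \<delta> \<and> H e = complex_of_real (\<nu> e) *\<^sub>C e"
    if "P E" for E
  proof -
    have "\<forall>e\<in>E. \<exists>r. e \<in> domH \<and> r < - \<delta> \<and> H e = complex_of_real r *\<^sub>C e"
      using that by (auto simp: P_def)
    then show ?thesis by (rule bchoice)
  qed
  have card_bound: "card E < nat \<lfloor>b / \<delta> powr \<gamma>\<rfloor> + 1" if E: "P E" for E
  proof -
    obtain \<nu> where \<nu>: "\<And>e. e \<in> E \<Longrightarrow> e \<in> domH" "\<And>e. e \<in> E \<Longrightarrow> \<nu> e < - \<delta>"
        "\<And>e. e \<in> E \<Longrightarrow> H e = complex_of_real (\<nu> e) *\<^sub>C e"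
      using choose[OF E] by blast
    have neg: "\<nu> e < 0" if "e \<in> E" for e using \<nu>(2)[OF that] \<delta> by linarith
    have "real (card E) * \<delta> powr \<gamma> = (\<Sum>e\<in>E. \<delta> powr \<gamma>)" by simp
    also have "\<dots> \<le> (\<Sum>e\<in>E. (- \<nu> e) powr \<gamma>)"
    proof (intro sum_mono powr_mono2)
      fix e assume "e \<in> E"
      then show "\<delta> \<le> - \<nu> e" using \<nu>(2)[of e] by linarith
    qed (use \<delta> \<gamma> in auto)
    finally have "real (card E) * \<delta> powr \<gamma> \<le> (\<Sum>e\<in>E. (- \<nu> e) powr \<gamma>)" .
    moreover have "ennreal (\<Sum>e\<in>E. (- \<nu> e) powr \<gamma>) \<le> ennreal b"
      using neg_trace_ge[of E domH H \<nu> \<gamma>] \<nu> neg E by (simp add: P_def b(1))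
    ultimately have "real (card E) * \<delta> powr \<gamma> \<le> b" using b(2) by simp
    then have "real (card E) \<le> b / \<delta> powr \<gamma>" using \<delta> by (simp add: pos_le_divide_eq)
    then have "int (card E) \<le> \<lfloor>b / \<delta> powr \<gamma>\<rfloor>" by (simp add: le_floor_iff)
    then show ?thesis by linarith
  qed
  have "P {}" by (simp add: P_def orthonormal_def)
  then obtain E where E: "P E" "\<And>F. P F \<Longrightarrow> card F \<le> card E"
    using ex_has_greatest_nat[of P "{}" card] card_bound by blast
  obtain \<nu> where \<nu>: "\<And>e. e \<in> E \<Longrightarrow> e \<in> domH" "\<And>e. e \<in> E \<Longrightarrow> \<nu> e < - \<delta>"
      "\<And>e. e \<in> E \<Longrightarrow> H e = complex_of_real (\<nu> e) *\<^sub>C e"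
    using choose[OF E(1)] by blast
  have max: "u = 0" if r: "r < - \<delta>" and u: "u \<in> domH" "H u = complex_of_real r *\<^sub>C u"
    and orth: "\<forall>e\<in>E. cinner u e = 0" for r u
  proof (rule ccontr)
    assume u0: "u \<noteq> 0"
    interpret T: partial_linear_operator domH H
      by (rule partial_linear_operator_assoc_op[OF sesquilinear dense])
    define x where "x = complex_of_real (1 / norm u) *\<^sub>C u"
    have x: "x \<in> domH" "H x = complex_of_real r *\<^sub>C x"
      using csubspaceD(3)[OF T.dom u(1)] T.scale[OF u(1)] u(2) by (auto simp: x_def mult.commute)
    have nx: "cinner x x = 1" using u0 by (simp add: cinner_self x_def norm_scaleC norm_divide)
    have xe: "cinner x e = 0" if "e \<in> E" for e using orth that by (simp add: x_def cinner_scaleC_left)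
    have ex: "cinner e x = 0" if "e \<in> E" for e using xe[OF that] cinner_commute[of e x] by simp
    have xE: "x \<notin> E" using xe nx by force
    have "P (insert x E)"
      using E(1) x r xe ex nx xE by (auto simp: P_def orthonormal_def)
    then have "card (insert x E) \<le> card E" by (rule E(2))
    then show False using xE E(1) by (simp add: P_def)
  qed
  show ?thesis
    by (rule that[of E \<nu>]) (use E(1) \<nu> max in \<open>auto simp: P_def\<close>)
qed

theorem sum_powr_le_neg_trace:
  assumes discrete: "discrete_neg_spectrum domH H"
    and U: "finite U" "orthonormal U" "U \<subseteq> D" "\<And>u. u \<in> U \<Longrightarrow> Re (h u u) < 0" and \<gamma>: "1 \<le> \<gamma>"
  shows "ennreal (\<Sum>u\<in>U. (- Re (h u u)) powr \<gamma>) \<le> neg_trace domH H \<gamma>"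
proof (cases "neg_trace domH H \<gamma> < \<infinity>")
  case True
  then obtain b where b: "neg_trace domH H \<gamma> = ennreal b" "0 \<le> b"
    by (cases "neg_trace domH H \<gamma>") auto
  \<comment> \<open>For \<delta> below \<open>m\<close>, all bases -Re h(u,u) - \<delta> are
    positive and \<delta> < 1. The inserted 1 also covers an empty \<open>U\<close>.\<close>
  define m where "m = Min (insert 1 ((\<lambda>u. - Re (h u u)) ` U))"
  have m: "0 < m" "m \<le> 1" "\<And>u. u \<in> U \<Longrightarrow> m \<le> - Re (h u u)"
    using U by (auto simp: m_def)
  have approx: "(\<Sum>u\<in>U. (- Re (h u u) - \<delta>) powr \<gamma>) \<le> b" if \<delta>: "0 < \<delta>" "\<delta> < m" for \<delta>
  proof -
    have "0 \<le> \<gamma>" using \<gamma> by simp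
    from maximal_eigenvectors[OF True \<delta>(1) this]
    obtain E \<nu> where E: "finite E" "orthonormal E" "\<And>e. e \<in> E \<Longrightarrow> e \<in> domH"
      "\<And>e. e \<in> E \<Longrightarrow> H e = complex_of_real (\<nu> e) *\<^sub>C e" and \<nu>: "\<And>e. e \<in> E \<Longrightarrow> \<nu> e < - \<delta>"
      and max: "\<And>r u. r < - \<delta> \<Longrightarrow> u \<in> domH \<Longrightarrow> H u = complex_of_real r *\<^sub>C u \<Longrightarrow>
        (\<forall>e\<in>E. cinner u e = 0) \<Longrightarrow> u = 0"
      by blast
    have neg: "\<nu> e < 0" if "e \<in> E" for e using \<nu>[OF that] \<delta> by linarith
    have spec: "is_eigenvalue domH H (complex_of_real r)"
      if "r < - \<delta>" "complex_of_real r \<in> op_spectrum domH H" for r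
      using discrete that \<delta>(1) by (simp add: discrete_neg_spectrum_def)
    have "\<delta> < 1" using \<delta> m by simp
    have lower: "(\<Sum>e\<in>E. \<nu> e * (cmod (cinner x e))\<^sup>2) - \<delta> * (norm x)\<^sup>2 \<le> Re (h x x)"
      if "x \<in> D" for x
      by (rule lower_bound[OF \<delta>(1) \<open>\<delta> < 1\<close> E(1,2) _ _ _ _ that]) (fact E(3) E(4) spec max)+
    \<comment> \<open>Jensen with the weights |<u,e>|^2, whose total over \<open>E\<close> is at
      most |u|^2 = 1 by Bessel.\<close>
    have single: "(- Re (h u u) - \<delta>) powr \<gamma> \<le> (\<Sum>e\<in>E. (cmod (cinner u e))\<^sup>2 * (- \<nu> e) powr \<gamma>)"
      if u: "u \<in> U" for u
    proof (rule powr_sum_ge)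
      have nu: "norm u = 1" by (rule orthonormal_norm[OF U(2) u])
      show "(\<Sum>e\<in>E. (cmod (cinner u e))\<^sup>2) \<le> 1" using bessel[OF E(1,2), of u] nu by simp
      show "0 < - Re (h u u) - \<delta>" using m(3)[OF u] \<delta> by linarith
      have "(\<Sum>e\<in>E. \<nu> e * (cmod (cinner u e))\<^sup>2) - \<delta> * (norm u)\<^sup>2 \<le> Re (h u u)"
        using lower U(3) u by blast
      then show "- Re (h u u) - \<delta> \<le> (\<Sum>e\<in>E. (cmod (cinner u e))\<^sup>2 * - \<nu> e)"
        by (simp add: nu sum_negf mult.commute)
    qed (use E neg \<gamma> in auto)
    have "(\<Sum>u\<in>U. (- Re (h u u) - \<delta>) powr \<gamma>)
        \<le> (\<Sum>u\<in>U. \<Sum>e\<in>E. (cmod (cinner u e))\<^sup>2 * (- \<nu> e) powr \<gamma>)"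
      by (rule sum_mono) (rule single)
    also have "\<dots> = (\<Sum>e\<in>E. \<Sum>u\<in>U. (cmod (cinner u e))\<^sup>2 * (- \<nu> e) powr \<gamma>)"
      by (rule sum.swap)
    also have "\<dots> = (\<Sum>e\<in>E. (\<Sum>u\<in>U. (cmod (cinner e u))\<^sup>2) * (- \<nu> e) powr \<gamma>)"
    proof -
      have "cmod (cinner u e) = cmod (cinner e u)" for u e :: 'a
        using cinner_commute[of u e] by simp
      then show ?thesis by (simp only: sum_distrib_right)
    qed
    \<comment> \<open>Bessel with the roles exchanged: now e is expanded along
      \<open>U\<close>.\<close>
    also have "\<dots> \<le> (\<Sum>e\<in>E. 1 * (- \<nu> e) powr \<gamma>)"
    proof (intro sum_mono mult_right_mono)
      fix e assume "e \<in> E"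
      then show "(\<Sum>u\<in>U. (cmod (cinner e u))\<^sup>2) \<le> 1"
        using bessel[OF U(1,2), of e] orthonormal_norm[OF E(2)] by simp
    qed simp
    finally have "(\<Sum>u\<in>U. (- Re (h u u) - \<delta>) powr \<gamma>) \<le> (\<Sum>e\<in>E. (- \<nu> e) powr \<gamma>)" by simp
    moreover have "(\<Sum>e\<in>E. (- \<nu> e) powr \<gamma>) \<le> b"
      using neg_trace_ge[of E domH H \<nu> \<gamma>] E neg b by simp
    ultimately show ?thesis by (rule order_trans)
  qed
  \<comment> \<open>The family \<open>E\<close> varies with \<delta>, but \<open>U\<close> and b do
    not: only a fixed finite sum of continuous functions passes to the limit.\<close>
  have "((\<lambda>\<delta>. \<Sum>u\<in>U. (- Re (h u u) - \<delta>) powr \<gamma>) \<longlongrightarrow> (\<Sum>u\<in>U. (- Re (h u u) - 0) powr \<gamma>)) (at_right 0)"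
    using U(4) by (intro tendsto_intros) force
  moreover have "\<forall>\<^sub>F \<delta> in at_right 0. (\<Sum>u\<in>U. (- Re (h u u) - \<delta>) powr \<gamma>) \<le> b"
    using approx m(1) unfolding eventually_at_right_field by blast
  ultimately have "(\<Sum>u\<in>U. (- Re (h u u) - 0) powr \<gamma>) \<le> b"
    by (rule tendsto_upperbound) simp
  then show ?thesis using b by (simp add: ennreal_leI)
qed (simp add: not_less top_unique)

text \<open>Without negative spectrum the empty family is maximal for every cut-off \<delta>, so
  h(x,x) >= -\<delta> |x|^2; a \<delta> adapted to x rules out a negative value.\<close>

lemma nonneg_of_no_negative_spectrum:
  assumes "\<And>r. r < 0 \<Longrightarrow> complex_of_real r \<notin> op_spectrum domH H" and x: "x \<in> D"
  shows "0 \<le> Re (h x x)"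
proof (rule ccontr)
  assume neg: "\<not> ?thesis"
  then have x0: "x \<noteq> 0"
    using sesquilinear_form_0[OF sesquilinear csubspaceD(1)[OF q.subspace]] by auto
  have no_eigen: "u = 0" if r: "r < 0" and u: "u \<in> domH" "H u = complex_of_real r *\<^sub>C u" for r u
  proof -
    interpret T: partial_linear_operator domH H
      by (rule partial_linear_operator_assoc_op[OF sesquilinear dense])
    have 0: "0 \<in> domH" "H 0 = 0"
      using csubspaceD(1)[OF T.dom] T.scale[OF u(1), of 0] by auto
    have "inj_on (\<lambda>u. complex_of_real r *\<^sub>C u - H u) domH"
      using assms(1)[OF r] by (auto simp: op_spectrum_def resolvent_set_def bij_betw_def)
    then show ?thesis using u 0 by (auto dest: inj_onD[of _ _ u 0])
  qed
  \<comment> \<open>Half of -h(x,x) / |x|^2, capped to keep \<delta> < 1.\<close>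
  define \<delta> where "\<delta> = min (1 / 2) (- Re (h x x) / (2 * (norm x)\<^sup>2))"
  have "0 < - Re (h x x) / (2 * (norm x)\<^sup>2)"
    using neg x0 by (intro divide_pos_pos) auto
  then have \<delta>: "0 < \<delta>" "\<delta> < 1" by (auto simp: \<delta>_def)
  have "- \<delta> * (norm x)\<^sup>2 \<le> Re (h x x)"
  proof (rule lower_bound_orthogonal[where E = "{}", OF \<delta>])
    show "u = 0" if "r < - \<delta>" "u \<in> domH" "H u = complex_of_real r *\<^sub>C u" for r u
      using no_eigen[of r u] that \<delta>(1) by simp
  qed (use assms \<delta>(1) in \<open>auto simp: orthonormal_def\<close>)
  moreover have "\<delta> * (norm x)\<^sup>2 \<le> - Re (h x x) / (2 * (norm x)\<^sup>2) * (norm x)\<^sup>2"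
    by (intro mult_right_mono) (auto simp: \<delta>_def)
  then have "\<delta> * (norm x)\<^sup>2 \<le> - Re (h x x) / 2" using x0 by simp
  ultimately show False using neg by simp
qed

end

section \<open>The symmetric part of the form and the conclusion\<close>

lemma Re_sym_part: "Re (sym_part a u u) = Re (a u u)"
  by (simp add: sym_part_def)

text \<open>The delicate point is completeness: \<open>closed_form\<close> measures Cauchy sequences
  by |a(v,v)|, whereas the form norm of the symmetric part sees only Re a(v,v). Continuity controls
  the former by the latter.\<close>

lemma closed_symmetric_form_sym_part:
  fixes D :: "'a::chilbert_space set"
  assumes a: "sesquilinear_form D a" and D: "densely_defined D"
    and cont: "continuous_form D a" and closed: "closed_form D a"
  shows "\<exists>w. closed_symmetric_form D (sym_part a) w"
proof -
  obtain w0 M where w0: "\<And>u. u \<in> D \<Longrightarrow> 0 \<le> Re (a u u) + w0 * (norm u)\<^sup>2"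
    and M: "\<And>u v. u \<in> D \<Longrightarrow> v \<in> D \<Longrightarrow> cmod (a u v) \<le>
        M * sqrt (Re (a u u) + w0 * (norm u)\<^sup>2) * sqrt (Re (a v v) + w0 * (norm v)\<^sup>2)"
    using cont unfolding continuous_form_def form_bounded_below_def by blast
  \<comment> \<open>\<open>w0\<close> may be negative; the added 1 makes the form norm dominate the
    Hilbert norm.\<close>
  define w where "w = max w0 0 + 1"
  have w: "w0 + 1 \<le> w" "1 \<le> w" by (auto simp: w_def)
  have lower: "Re (a u u) + w0 * (norm u)\<^sup>2 + (norm u)\<^sup>2 \<le> Re (a u u) + w * (norm u)\<^sup>2" for u
    using mult_right_mono[OF w(1), of "(norm u)\<^sup>2"] by (simp add: algebra_simps)
  have "closed_symmetric_form D (sym_part a) w"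
  proof
    show "sesquilinear_form D (sym_part a)"
      using a by (auto simp: sesquilinear_form_def sym_part_def field_simps)
    show "sym_part a v u = cnj (sym_part a u v)" for u v
      by (simp add: sym_part_def)
    show "(norm u)\<^sup>2 \<le> Re (sym_part a u u) + w * (norm u)\<^sup>2" if "u \<in> D" for u
      using lower[of u] w0[OF that] unfolding Re_sym_part by linarith
    fix x :: "nat \<Rightarrow> 'a"
    assume x: "\<And>n. x n \<in> D"
      and cauchy: "\<forall>e>0. \<exists>N. \<forall>n\<ge>N. \<forall>m\<ge>N.
        Re (sym_part a (x n - x m) (x n - x m)) + w * (norm (x n - x m))\<^sup>2 < e"
    have d: "x n - x m \<in> D" for n m using x sesquilinear_formD(1)[OF a] csubspaceD(4) by blast
    have "Cauchy x"
    proof (rule CauchyI)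
      fix e :: real assume e: "0 < e"
      then obtain N where N: "\<forall>n\<ge>N. \<forall>m\<ge>N.
          Re (a (x n - x m) (x n - x m)) + w * (norm (x n - x m))\<^sup>2 < e\<^sup>2"
        using cauchy[rule_format, of "e\<^sup>2"] by (auto simp: Re_sym_part)
      have "norm (x n - x m) < e" if "n \<ge> N" "m \<ge> N" for n m
      proof -
        have "(norm (x n - x m))\<^sup>2 < e\<^sup>2"
          using N that lower[of "x n - x m"] w0[OF d[of n m]] by (smt (verit))
        then show ?thesis using e power2_less_imp_less by (metis less_imp_le)
      qed
      then show "\<exists>M. \<forall>m\<ge>M. \<forall>n\<ge>M. norm (x m - x n) < e" by blast
    qed
    then obtain u where u: "x \<longlonglongrightarrow> u" using Cauchy_convergent convergent_def by blast
    \<comment> \<open>The sign of \<open>M\<close> is unknown; |M| + 1 is positive, so it can be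
      divided by below.\<close>
    have diag: "cmod (a v v) \<le> (\<bar>M\<bar> + 1) * (Re (a v v) + w * (norm v)\<^sup>2)" if v: "v \<in> D" for v
    proof -
      let ?t = "Re (a v v) + w0 * (norm v)\<^sup>2"
      have "cmod (a v v) \<le> M * ?t" using M[OF v v] w0[OF v] by (simp add: mult.assoc)
      also have "\<dots> \<le> (\<bar>M\<bar> + 1) * ?t" using w0[OF v] by (intro mult_right_mono) auto
      also have "\<dots> \<le> (\<bar>M\<bar> + 1) * (Re (a v v) + w * (norm v)\<^sup>2)"
        using lower[of v] by (intro mult_left_mono) (auto intro: order_trans[rotated])
      finally show ?thesis .
    qed
    have "\<exists>N. \<forall>n\<ge>N. \<forall>m\<ge>N. cmod (a (x n - x m) (x n - x m)) < e" if e: "0 < e" for e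
    proof -
      have "0 < e / (\<bar>M\<bar> + 1)" using e by (intro divide_pos_pos) auto
      then obtain N where N: "\<forall>n\<ge>N. \<forall>m\<ge>N.
          Re (a (x n - x m) (x n - x m)) + w * (norm (x n - x m))\<^sup>2 < e / (\<bar>M\<bar> + 1)"
        using cauchy[rule_format, of "e / (\<bar>M\<bar> + 1)"] by (auto simp: Re_sym_part)
      have "cmod (a (x n - x m) (x n - x m)) < e" if "n \<ge> N" "m \<ge> N" for n m
      proof -
        have "(\<bar>M\<bar> + 1) * (Re (a (x n - x m) (x n - x m)) + w * (norm (x n - x m))\<^sup>2)
            < (\<bar>M\<bar> + 1) * (e / (\<bar>M\<bar> + 1))"
          using N that by (intro mult_strict_left_mono) auto
        then show ?thesis using diag[OF d[of n m]] by (simp add: add_nonneg_eq_0_iff)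
      qed
      then show ?thesis by blast
    qed
    then have uD: "u \<in> D" and lim: "(\<lambda>n. a (x n - u) (x n - u)) \<longlonglongrightarrow> 0"
      using closed x u unfolding closed_form_def by blast+
    have "(\<lambda>n. Re (a (x n - u) (x n - u)) + w * (norm (x n - u))\<^sup>2) \<longlonglongrightarrow> Re 0 + w * 0\<^sup>2"
      using tendsto_norm_zero[OF LIM_zero[OF u]] by (intro tendsto_intros lim)
    then show "\<exists>u\<in>D. (\<lambda>n. Re (sym_part a (x n - u) (x n - u)) + w * (norm (x n - u))\<^sup>2) \<longlonglongrightarrow> 0"
      using uD by (intro bexI[of _ u]) (simp_all add: Re_sym_part)
  qed (use D w in auto)
  then show ?thesis ..
qed

theorem theorem1:
  fixes D :: "'a::chilbert_space set"
    and a :: "'a \<Rightarrow> 'a \<Rightarrow> complex"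
    and \<eta> :: real
  assumes "sesquilinear_form D a"
    and "densely_defined D"
    and "continuous_form D a"
    and "closed_form D a"
    and "form_bounded_below D a \<eta>"
  shows "((\<forall>r::real. r < 0 \<longrightarrow> complex_of_real r \<notin> op_spectrum (assoc_dom D (sym_part a)) (assoc_op D (sym_part a)))
            \<longrightarrow> (\<forall>z. Re z < 0 \<longrightarrow> \<not> is_eigenvalue (assoc_dom D a) (assoc_op D a) z))
       \<and> (discrete_neg_spectrum (assoc_dom D (sym_part a)) (assoc_op D (sym_part a))
            \<longrightarrow> (\<forall>(ls::complex list) (\<gamma>::real).
                  (\<forall>z\<in>set ls. is_eigenvalue (assoc_dom D a) (assoc_op D a) z \<and> Re z < 0)
                  \<longrightarrow> (\<forall>z. enat (count_list ls z) \<le> alg_mult (assoc_dom D a) (assoc_op D a) z)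
                  \<longrightarrow> \<gamma> \<ge> 1
                  \<longrightarrow> ennreal (\<Sum>z\<leftarrow>ls. (- Re z) powr \<gamma>)
                        \<le> neg_trace (assoc_dom D (sym_part a)) (assoc_op D (sym_part a)) \<gamma>))"
proof -
  note D = assms(2)
  obtain w where "closed_symmetric_form D (sym_part a) w"
    using closed_symmetric_form_sym_part[OF assms(1-4)] by blast
  then interpret closed_symmetric_form D "sym_part a" w .
  interpret A: partial_linear_operator "assoc_dom D a" "assoc_op D a"
    by (rule partial_linear_operator_assoc_op[OF assms(1) D])
  show ?thesis
  proof (intro conjI impI allI notI)
    fix z
    assume spec: "\<forall>r::real. r < 0 \<longrightarrow> complex_of_real r \<notin> op_spectrum domH H"
      and z: "Re z < 0" and "is_eigenvalue (assoc_dom D a) (assoc_op D a) z"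
    then obtain u where u: "u \<in> assoc_dom D a" "u \<noteq> 0" "assoc_op D a u = z *\<^sub>C u"
      by (auto simp: is_eigenvalue_def)
    note uD = assoc_opD[OF D u(1)]
    have "Re (a u u) = Re z * (norm u)\<^sup>2"
      using uD(2)[OF uD(1)] u(3) by (simp add: cinner_scaleC_left cinner_self del: of_real_power)
    moreover have "0 \<le> Re (a u u)"
      using nonneg_of_no_negative_spectrum[OF _ uD(1)] spec by (simp add: Re_sym_part)
    ultimately show False using z u(2) by (simp add: zero_le_mult_iff)
  next
    fix ls :: "complex list" and \<gamma> :: real
    assume discrete: "discrete_neg_spectrum domH H"
      and ls: "\<forall>z\<in>set ls. is_eigenvalue (assoc_dom D a) (assoc_op D a) z \<and> Re z < 0"
      and count: "\<forall>z. enat (count_list ls z) \<le> alg_mult (assoc_dom D a) (assoc_op D a) z"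
      and \<gamma>: "1 \<le> \<gamma>"
    obtain es where es: "schur_list (assoc_dom D a) (assoc_op D a) es ls"
      using A.schur_list_exists count by blast
    note es' = schur_list_orthonormal[OF es]
    have esD: "set es \<subseteq> D" using es' assoc_opD(1)[OF D] by blast
    have "cinner (assoc_op D a e) e = a e e" if e: "e \<in> set es" for e
    proof -
      have "e \<in> assoc_dom D a" using es' e by blast
      from assoc_opD(2)[where a = a, OF D this subsetD[OF esD e]] show ?thesis by simp
    qed
    \<comment> \<open>Here the eigenvalues of \<open>A\<close> become diagonal values of the form.
      Their real parts are values of the symmetric part, to which the bound through \<open>H\<close>
      applies.\<close>
    then have ls_eq: "ls = map (\<lambda>e. a e e) es"
      using schur_list_diagonal[OF es] by simp
    have "(\<Sum>z\<leftarrow>ls. (- Re z) powr \<gamma>) = (\<Sum>e\<in>set es. (- Re (sym_part a e e)) powr \<gamma>)"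
      unfolding ls_eq using es' by (simp add: sum_list_distinct_conv_sum_set Re_sym_part o_def)
    moreover have "Re (sym_part a e e) < 0" if "e \<in> set es" for e
      using ls that by (simp add: ls_eq Re_sym_part)
    ultimately show "ennreal (\<Sum>z\<leftarrow>ls. (- Re z) powr \<gamma>) \<le> neg_trace domH H \<gamma>"
      using sum_powr_le_neg_trace[OF discrete _ _ esD _ \<gamma>] es' by simp
  qed
qed

end
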